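(* Let $A:E\to E$ be a hyperbolic bundle automorphism covering a homeomorphism $f:X\to X$, with invariant splitting $E_x=E^s_x\oplus E^u_x$. Then there exist a continuous norm $\|\cdot\|^*$ on $E$ and a constant $\tau\in(0,1)$ such that for all $x\in X$ $$\|A(v)\|^*_{f(x)}\le\tau\|v\|^*_x\quad\text{for } v\in E^s_x,\qquad \|A^{-1}(v)\|^*_{f^{-1}(x)}\le\tau\|v\|^*_x\quad\text{for } v\in E^u_x.$$ In addition, the new continuous norm is equivalent to the original one: there exist constants $r_1,r_2>0$ independent of $x$ such that $$r_1\|v\|_x\le\|v\|^*_x\le r_2\|v\|_x\qquad\text{for each } v\in E_x\text{ and each } x\in X.$$
   Context: $X$ is a compact metric space, $\pi:E\to X$ is a continuous (real, finite rank) vector bundle with fibers $E_x$, equipped with a continuous Riemannian metric; $\|\cdot\|_x$ denotes the (original) norm it induces on $E_x$. A continuous norm on $E$ is a continuous function $\|\cdot\|^*:E\to\mathbb R$ whose restriction $\|\cdot\|^*_x$ to each fiber $E_x$ is a norm. A continuous bundle automorphism $A:E\to E$ covering a homeomorphism $f:X\to X$ is hyperbolic if there is a continuous splitting $E_x=E^s_x\oplus E^u_x$ ($x\in X$) with $A(E^s_x)=E^s_{f(x)}$, $A(E^u_x)=E^u_{f(x)}$, and constants $C>0$, $\lambda\in(0,1)$ such that for all $n\ge 0$ and $x\in X$: $\|A^n(v)\|_{f^n(x)}\le C\lambda^n\|v\|_x$ for $v\in E^s_x$ and $\|A^{-n}(v)\|_{f^{-n}(x)}\le C\lambda^n\|v\|_x$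 for $v\in E^u_x$. *)

theory Defs
  imports "HOL-Analysis.Analysis"
begin

definition real_vector_space_on ::
  "'e set \<Rightarrow> ('e \<Rightarrow> 'e \<Rightarrow> 'e) \<Rightarrow> (real \<Rightarrow> 'e \<Rightarrow> 'e) \<Rightarrow> 'e \<Rightarrow> bool"
  where "real_vector_space_on V add scl z \<longleftrightarrow>
    z \<in> V \<and>
    (\<forall>v\<in>V. \<forall>w\<in>V. add v w \<in> V) \<and>
    (\<forall>c. \<forall>v\<in>V. scl c v \<in> V) \<and>
    (\<forall>u\<in>V. \<forall>v\<in>V. \<forall>w\<in>V. add (add u v) w = add u (add v w)) \<and>
    (\<forall>v\<in>V. \<forall>w\<in>V. add v w = add w v) \<and>
    (\<forall>v\<in>V. add z v = v) \<and>
    (\<forall>v\<in>V. \<exists>w\<in>V. add v w = z) \<and>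
    (\<forall>c. \<forall>v\<in>V. \<forall>w\<in>V. scl c (add v w) = add (scl c v) (scl c w)) \<and>
    (\<forall>a b. \<forall>v\<in>V. scl (a + b) v = add (scl a v) (scl b v)) \<and>
    (\<forall>a b. \<forall>v\<in>V. scl a (scl b v) = scl (a * b) v) \<and>
    (\<forall>v\<in>V. scl 1 v = v)"

definition subspace_on ::
  "'e set \<Rightarrow> 'e set \<Rightarrow> ('e \<Rightarrow> 'e \<Rightarrow> 'e) \<Rightarrow> (real \<Rightarrow> 'e \<Rightarrow> 'e) \<Rightarrow> 'e \<Rightarrow> bool"
  where "subspace_on V W add scl z \<longleftrightarrow>
    W \<subseteq> V \<and> z \<in> W \<and>
    (\<forall>v\<in>W. \<forall>w\<in>W. add v w \<in> W) \<and> (\<forall>c. \<forall>v\<in>W. scl c v \<in> W)"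

text \<open>The fiberwise operations are total functions on the type of the total space;
  they are meaningful only for vectors of the same fiber. \<open>vzero\<close> is the zero section.\<close>

record ('x, 'e) bundle_data =
  total :: "'e topology"
  proj :: "'e \<Rightarrow> 'x"
  vadd :: "'e \<Rightarrow> 'e \<Rightarrow> 'e"
  vscale :: "real \<Rightarrow> 'e \<Rightarrow> 'e"
  vzero :: "'x \<Rightarrow> 'e"

definition fiber :: "('x, 'e) bundle_data \<Rightarrow> 'x \<Rightarrow> 'e set"
  where "fiber E x = {v \<in> topspace (total E). proj E v = x}"

text \<open>\<open>Euclidean_space n\<close> is \<open>\<real>\<^sup>n\<close>, realised as the functions \<open>nat \<Rightarrow> real\<close> vanishing at
  all indices \<open>i \<ge> n\<close>.\<close>

definition local_trivialization ::
  "'x topology \<Rightarrow> ('x, 'e) bundle_data \<Rightarrow> 'x set \<Rightarrow> nat \<Rightarrow> ('e \<Rightarrow> 'x \<times> (nat \<Rightarrow> real)) \<Rightarrow> bool"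
  where "local_trivialization B E U n \<phi> \<longleftrightarrow>
    homeomorphic_map
      (subtopology (total E) {v \<in> topspace (total E). proj E v \<in> U})
      (prod_topology (subtopology B U) (Euclidean_space n)) \<phi> \<and>
    (\<forall>x\<in>U. \<forall>v\<in>fiber E x. fst (\<phi> v) = x) \<and>
    (\<forall>x\<in>U. \<forall>v\<in>fiber E x. \<forall>w\<in>fiber E x. \<forall>i.
       snd (\<phi> (vadd E v w)) i = snd (\<phi> v) i + snd (\<phi> w) i) \<and>
    (\<forall>x\<in>U. \<forall>v\<in>fiber E x. \<forall>c i. snd (\<phi> (vscale E c v)) i = c * snd (\<phi> v) i)"

text \<open>The rank \<open>n\<close> is finite, and locally constant by local triviality; it is not required to
  agree on different components of the base.\<close>

definition vector_bundle :: "'x topology \<Rightarrow> ('x, 'e) bundle_data \<Rightarrow> bool"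
  where "vector_bundle B E \<longleftrightarrow>
    continuous_map (total E) B (proj E) \<and>
    (\<forall>x\<in>topspace B. real_vector_space_on (fiber E x) (vadd E) (vscale E) (vzero E x)) \<and>
    (\<forall>x\<in>topspace B. \<exists>U n \<phi>. openin B U \<and> x \<in> U \<and> local_trivialization B E U n \<phi>)"

text \<open>A subbundle is a family of linear subspaces of the fibers whose union, with the subspace
  topology and the restricted operations, is itself a vector bundle.\<close>

definition restrict_bundle ::
  "'x topology \<Rightarrow> ('x, 'e) bundle_data \<Rightarrow> ('x \<Rightarrow> 'e set) \<Rightarrow> ('x, 'e) bundle_data"
  where "restrict_bundle B E F =
    E\<lparr>total := subtopology (total E) (\<Union>x\<in>topspace B. F x)\<rparr>"

definition subbundle :: "'x topology \<Rightarrow> ('x, 'e) bundle_data \<Rightarrow> ('x \<Rightarrow> 'e set) \<Rightarrow> bool"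
  where "subbundle B E F \<longleftrightarrow>
    (\<forall>x\<in>topspace B. subspace_on (fiber E x) (F x) (vadd E) (vscale E) (vzero E x)) \<and>
    vector_bundle B (restrict_bundle B E F)"

definition continuous_splitting ::
  "'x topology \<Rightarrow> ('x, 'e) bundle_data \<Rightarrow> ('x \<Rightarrow> 'e set) \<Rightarrow> ('x \<Rightarrow> 'e set) \<Rightarrow> bool"
  where "continuous_splitting B E Es Eu \<longleftrightarrow>
    subbundle B E Es \<and> subbundle B E Eu \<and>
    (\<forall>x\<in>topspace B. \<forall>v\<in>fiber E x. \<exists>!p. p \<in> Es x \<times> Eu x \<and> v = vadd E (fst p) (snd p))"

definition riemannian_metric ::
  "'x topology \<Rightarrow> ('x, 'e) bundle_data \<Rightarrow> ('e \<Rightarrow> 'e \<Rightarrow> real) \<Rightarrow> bool"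
  where "riemannian_metric B E g \<longleftrightarrow>
    continuous_map
      (subtopology (prod_topology (total E) (total E)) {(v, w). proj E v = proj E w})
      euclideanreal (\<lambda>(v, w). g v w) \<and>
    (\<forall>x\<in>topspace B.
      (\<forall>v\<in>fiber E x. \<forall>w\<in>fiber E x. g v w = g w v) \<and>
      (\<forall>u\<in>fiber E x. \<forall>v\<in>fiber E x. \<forall>w\<in>fiber E x. g (vadd E u v) w = g u w + g v w) \<and>
      (\<forall>c. \<forall>v\<in>fiber E x. \<forall>w\<in>fiber E x. g (vscale E c v) w = c * g v w) \<and>
      (\<forall>v\<in>fiber E x. v \<noteq> vzero E x \<longrightarrow> g v v > 0))"

definition metric_norm :: "('e \<Rightarrow> 'e \<Rightarrow> real) \<Rightarrow> 'e \<Rightarrow> real"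
  where "metric_norm g v = sqrt (g v v)"

definition norm_on ::
  "'e set \<Rightarrow> ('e \<Rightarrow> 'e \<Rightarrow> 'e) \<Rightarrow> (real \<Rightarrow> 'e \<Rightarrow> 'e) \<Rightarrow> 'e \<Rightarrow> ('e \<Rightarrow> real) \<Rightarrow> bool"
  where "norm_on V add scl z N \<longleftrightarrow>
    (\<forall>v\<in>V. 0 \<le> N v) \<and> (\<forall>v\<in>V. N v = 0 \<longleftrightarrow> v = z) \<and>
    (\<forall>c. \<forall>v\<in>V. N (scl c v) = \<bar>c\<bar> * N v) \<and>
    (\<forall>v\<in>V. \<forall>w\<in>V. N (add v w) \<le> N v + N w)"

definition continuous_norm ::
  "'x topology \<Rightarrow> ('x, 'e) bundle_data \<Rightarrow> ('e \<Rightarrow> real) \<Rightarrow> bool"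
  where "continuous_norm B E N \<longleftrightarrow>
    continuous_map (total E) euclideanreal N \<and>
    (\<forall>x\<in>topspace B. norm_on (fiber E x) (vadd E) (vscale E) (vzero E x) N)"

definition bundle_automorphism ::
  "'x topology \<Rightarrow> ('x, 'e) bundle_data \<Rightarrow> ('x \<Rightarrow> 'x) \<Rightarrow> ('e \<Rightarrow> 'e) \<Rightarrow> bool"
  where "bundle_automorphism B E f A \<longleftrightarrow>
    homeomorphic_map B B f \<and>
    homeomorphic_map (total E) (total E) A \<and>
    (\<forall>v\<in>topspace (total E). proj E (A v) = f (proj E v)) \<and>
    (\<forall>x\<in>topspace B. \<forall>v\<in>fiber E x. \<forall>w\<in>fiber E x. A (vadd E v w) = vadd E (A v) (A w)) \<and>
    (\<forall>x\<in>topspace B. \<forall>c. \<forall>v\<in>fiber E x. A (vscale E c v) = vscale E c (A v))"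

definition bundle_inv :: "('x, 'e) bundle_data \<Rightarrow> ('e \<Rightarrow> 'e) \<Rightarrow> 'e \<Rightarrow> 'e"
  where "bundle_inv E A = inv_into (topspace (total E)) A"

text \<open>\<open>nrm\<close> is the norm on the total space with respect to which the contraction estimates
  hold; the base points \<open>f\<^sup>n x\<close> and \<open>f\<^sup>-\<^sup>n x\<close> are those of the vectors it is applied to.\<close>

definition hyperbolic_automorphism ::
  "'x topology \<Rightarrow> ('x, 'e) bundle_data \<Rightarrow> ('e \<Rightarrow> real) \<Rightarrow> ('x \<Rightarrow> 'x) \<Rightarrow> ('e \<Rightarrow> 'e) \<Rightarrow>
    ('x \<Rightarrow> 'e set) \<Rightarrow> ('x \<Rightarrow> 'e set) \<Rightarrow> bool"
  where "hyperbolic_automorphism B E nrm f A Es Eu \<longleftrightarrow>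
    bundle_automorphism B E f A \<and>
    continuous_splitting B E Es Eu \<and>
    (\<forall>x\<in>topspace B. A ` Es x = Es (f x) \<and> A ` Eu x = Eu (f x)) \<and>
    (\<exists>C>0. \<exists>l>0. l < 1 \<and>
      (\<forall>n. \<forall>x\<in>topspace B.
        (\<forall>v\<in>Es x. nrm ((A ^^ n) v) \<le> C * l ^ n * nrm v) \<and>
        (\<forall>v\<in>Eu x. nrm ((bundle_inv E A ^^ n) v) \<le> C * l ^ n * nrm v)))"

end

theory Submission
  imports Defs
begin

text \<open>
  On the stable bundle the norm \<open>p v = (\<Sum>k<m. \<mu>\<^bsup>-k\<^esup> \<parallel>A\<^bsup>k\<^esup> v\<parallel>)\<close> with \<open>\<lambda> < \<mu> < 1\<close> and \<open>C (\<lambda>/\<mu>)\<^bsup>m\<^esup> \<le> 1\<close>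
  is contracted by the factor \<open>\<mu>\<close>, because applying \<open>A\<close> shifts the sum and the new last term is
  dominated by the lost first one. The same construction for \<open>A\<^sup>-\<^sup>1\<close> gives \<open>q\<close>, and
  \<open>N (s + u) = p s + q u\<close> for \<open>s \<in> E\<^sup>s\<close>, \<open>u \<in> E\<^sup>u\<close>. Compactness yields \<open>p s \<le> M \<parallel>s + u\<parallel>\<close>, which
  gives both the equivalence of the norms and the continuity of \<open>N\<close>.
\<close>

subsection \<open>Linear algebra in a fiber\<close>

text \<open>The obstacle is the continuity of \<open>N\<close>. The splitting is continuous only in
  the sense that each summand has local trivializations of its own, so continuity of the
  decomposition has to be derived. The projections themselves are never shown continuous; only the
  real function "\<open>p\<close> of the component" is, by comparing the component with a nearby
  section of the same subbundle. That comparison needs a bound of a component by the whole vector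
  with a constant uniform in the base point, so the domination estimate has to come before
  continuity. Truncating the sum over iterates keeps \<open>p\<close> a finite sum of continuous
  functions, and the gap between \<open>l\<close> and \<mu> lets a large \<open>m\<close> beat the
  constant \<open>C\<close>. The fibers are subsets of one type with total operations, hence the
  fiberwise linear algebra is done in locales over a carrier set.\<close>

locale real_vector_carrier =
  fixes V :: "'e set" and add :: "'e \<Rightarrow> 'e \<Rightarrow> 'e" and scl :: "real \<Rightarrow> 'e \<Rightarrow> 'e" and z :: 'e
  assumes vector_space: "real_vector_space_on V add scl z"
begin

abbreviation diff :: "'e \<Rightarrow> 'e \<Rightarrow> 'e"
  where "diff v w \<equiv> add v (scl (-1) w)"

lemma zero_closed [simp]: "z \<in> V"
  and add_closed [simp]: "v \<in> V \<Longrightarrow> w \<in> V \<Longrightarrow> add v w \<in> V"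
  and scl_closed [simp]: "v \<in> V \<Longrightarrow> scl c v \<in> V"
  and add_assoc: "u \<in> V \<Longrightarrow> v \<in> V \<Longrightarrow> w \<in> V \<Longrightarrow> add (add u v) w = add u (add v w)"
  and add_commute: "v \<in> V \<Longrightarrow> w \<in> V \<Longrightarrow> add v w = add w v"
  and add_zero_left [simp]: "v \<in> V \<Longrightarrow> add z v = v"
  and scl_add: "v \<in> V \<Longrightarrow> w \<in> V \<Longrightarrow> scl c (add v w) = add (scl c v) (scl c w)"
  and add_scl: "v \<in> V \<Longrightarrow> scl (a + b) v = add (scl a v) (scl b v)"
  and scl_scl: "v \<in> V \<Longrightarrow> scl a (scl b v) = scl (a * b) v"
  and scl_one [simp]: "v \<in> V \<Longrightarrow> scl 1 v = v"
  using vector_space by (auto simp: real_vector_space_on_def)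

lemma ex_neg: "v \<in> V \<Longrightarrow> \<exists>w\<in>V. add v w = z"
  using vector_space unfolding real_vector_space_on_def by meson

lemma add_zero_right [simp]: "v \<in> V \<Longrightarrow> add v z = v"
  using add_commute add_zero_left zero_closed by metis

lemma scl_zero_left [simp]: "scl 0 v = z" if v: "v \<in> V"
proof -
  obtain w where w: "w \<in> V" "add (scl 0 v) w = z"
    using ex_neg v scl_closed by blast
  have "add (scl 0 v) (scl 0 v) = scl 0 v"
    using add_scl[OF v, of 0 0] by simp
  then have "add (scl 0 v) z = z"
    using w v add_assoc[of "scl 0 v" "scl 0 v" w] by simp
  then show ?thesis
    using v by simp
qed

lemma scl_zero_right [simp]: "scl c z = z"
  using scl_scl[OF zero_closed, of c 0] by simp

lemma vdiff_self: "v \<in> V \<Longrightarrow> diff v v = z"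
  using add_scl[of v 1 "-1"] by simp

lemma vdiff_vadd_cancel: "v \<in> V \<Longrightarrow> w \<in> V \<Longrightarrow> add (diff v w) w = v"
  using add_assoc[of v "scl (-1) w" w] add_commute[of "scl (-1) w" w] vdiff_self by simp

lemma minus_diff: "v \<in> V \<Longrightarrow> w \<in> V \<Longrightarrow> scl (-1) (diff v w) = diff w v"
  using scl_add[of v "scl (-1) w" "-1"] scl_scl[of w "-1" "-1"] add_commute[of w "scl (-1) v"]
  by simp

lemma add_add_swap:
  "a \<in> V \<Longrightarrow> b \<in> V \<Longrightarrow> c \<in> V \<Longrightarrow> d \<in> V \<Longrightarrow> add (add a b) (add c d) = add (add a c) (add b d)"
  using add_assoc add_commute add_closed by metis

text \<open>The reverse triangle inequality. It later converts closeness of a component to a section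
  into closeness of their norms.\<close>

lemma norm_on_diff:
  assumes N: "norm_on V add scl z N" and v: "v \<in> V" and w: "w \<in> V"
  shows "\<bar>N v - N w\<bar> \<le> N (diff v w)"
proof -
  have tri: "N a \<le> N (diff a b) + N b" if "a \<in> V" "b \<in> V" for a b
  proof -
    have "N (add (diff a b) b) \<le> N (diff a b) + N b"
      using N that unfolding norm_on_def by (meson add_closed scl_closed)
    then show ?thesis
      using vdiff_vadd_cancel[OF that] by simp
  qed
  have "N (diff w v) = \<bar>-1\<bar> * N (diff v w)"
    using N minus_diff[OF v w] v w unfolding norm_on_def by (metis add_closed scl_closed)
  then show ?thesis
    using tri[OF v w] tri[OF w v] by simp
qed

end

section \<open>Inner products on a fiber\<close>

locale inner_product_carrier = real_vector_carrier V add scl z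
  for V :: "'e set" and add scl z +
  fixes g :: "'e \<Rightarrow> 'e \<Rightarrow> real"
  assumes inner_commute: "v \<in> V \<Longrightarrow> w \<in> V \<Longrightarrow> g v w = g w v"
    and inner_add_left: "u \<in> V \<Longrightarrow> v \<in> V \<Longrightarrow> w \<in> V \<Longrightarrow> g (add u v) w = g u w + g v w"
    and inner_scl_left: "v \<in> V \<Longrightarrow> w \<in> V \<Longrightarrow> g (scl c v) w = c * g v w"
    and inner_pos: "v \<in> V \<Longrightarrow> v \<noteq> z \<Longrightarrow> g v v > 0"
begin

lemma inner_add_right: "u \<in> V \<Longrightarrow> v \<in> V \<Longrightarrow> w \<in> V \<Longrightarrow> g w (add u v) = g w u + g w v"
  using inner_commute inner_add_left add_closed by metis

lemma inner_scl_right: "v \<in> V \<Longrightarrow> w \<in> V \<Longrightarrow> g w (scl c v) = c * g w v"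
  using inner_commute inner_scl_left scl_closed by metis

lemmas inner_expand = inner_add_left inner_add_right inner_scl_left inner_scl_right

lemma inner_vzero_left: "v \<in> V \<Longrightarrow> g z v = 0"
  using inner_scl_left[of z v 0] by simp

lemma inner_nonneg: "v \<in> V \<Longrightarrow> 0 \<le> g v v"
  using inner_pos[of v] inner_vzero_left[of z] by (cases "v = z") auto

lemma inner_eq_zero: "v \<in> V \<Longrightarrow> g v v = 0 \<longleftrightarrow> v = z"
  using inner_pos[of v] inner_vzero_left[of z] by (cases "v = z") auto

text \<open>This is the expansion of the square of \<open>v - (s + u)\<close> for
  \<open>v = s' + u'\<close>. On the right \<open>s'\<close> and \<open>u'\<close> occur only
  through their sum, so the expression can be continuous in \<open>v\<close> before anything is
  known about the components of \<open>v\<close>.\<close>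

lemma inner_diff_diff:
  assumes "s \<in> V" "u \<in> V" "s' \<in> V" "u' \<in> V"
  shows "g (add (diff s' s) (diff u' u)) (add (diff s' s) (diff u' u)) =
    g (add s' u') (add s' u') + g (add s u) (add s u) - 2 * (g (add s' u') s + g (add s' u') u)"
  using assms
  by (simp add: inner_expand inner_commute[of s s'] inner_commute[of u u'] inner_commute[of s u']
      inner_commute[of u s'] inner_commute[of s u] inner_commute[of u' s'] algebra_simps)

lemma Cauchy_Schwarz:
  assumes v: "v \<in> V" and w: "w \<in> V"
  shows "g v w \<le> sqrt (g v v) * sqrt (g w w)"
proof (cases "w = z")
  case True
  then show ?thesis
    using v inner_commute[OF v zero_closed] by (simp add: inner_vzero_left)
next
  case False
  then have pos: "g w w > 0"
    using inner_pos w by simp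
  \<comment> \<open>This coefficient minimises the norm of \<open>v + c w\<close>: it removes the
    orthogonal projection of \<open>v\<close> onto \<open>w\<close>.\<close>
  define c where "c = - (g v w / g w w)"
  have "0 \<le> g (add v (scl c w)) (add v (scl c w))"
    using v w by (simp add: inner_nonneg)
  also have "\<dots> = g v v - (g v w)\<^sup>2 / g w w"
    using v w pos
    by (simp add: inner_expand inner_commute[of w v] c_def field_simps power2_eq_square)
  finally have "(g v w)\<^sup>2 \<le> g v v * g w w"
    using pos by (simp add: field_simps)
  then have "\<bar>g v w\<bar> \<le> sqrt (g v v * g w w)"
    using real_le_rsqrt by fastforce
  then show ?thesis
    by (simp add: real_sqrt_mult)
qed

lemma norm_on_metric_norm: "norm_on V add scl z (metric_norm g)"
  unfolding norm_on_def metric_norm_def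
proof (intro conjI ballI allI)
  fix v w assume v: "v \<in> V" and w: "w \<in> V"
  have "g (add v w) (add v w) = g v v + 2 * g v w + g w w"
    using v w by (simp add: inner_expand inner_commute[of w v])
  also have "\<dots> \<le> (sqrt (g v v) + sqrt (g w w))\<^sup>2"
    using Cauchy_Schwarz[OF v w] inner_nonneg[OF v] inner_nonneg[OF w]
    by (simp add: power2_sum)
  finally show "sqrt (g (add v w) (add v w)) \<le> sqrt (g v v) + sqrt (g w w)"
    using v w by (intro real_le_lsqrt) (auto simp: inner_nonneg)
next
  fix c v assume v: "v \<in> V"
  then have "g (scl c v) (scl c v) = c\<^sup>2 * g v v"
    by (simp add: inner_expand power2_eq_square)
  then show "sqrt (g (scl c v) (scl c v)) = \<bar>c\<bar> * sqrt (g v v)"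
    by (simp add: real_sqrt_mult)
qed (auto simp: inner_nonneg inner_eq_zero)

end


subsection \<open>Norms on a vector bundle\<close>

lemma vector_bundle_carrier:
  "vector_bundle B E \<Longrightarrow> x \<in> topspace B \<Longrightarrow>
    real_vector_carrier (fiber E x) (vadd E) (vscale E) (vzero E x)"
  by unfold_locales (simp add: vector_bundle_def)

lemma riemannian_metric_carrier:
  assumes "vector_bundle B E" "riemannian_metric B E g" "x \<in> topspace B"
  shows "inner_product_carrier (fiber E x) (vadd E) (vscale E) (vzero E x) g"
proof -
  interpret real_vector_carrier "fiber E x" "vadd E" "vscale E" "vzero E x"
    by (rule vector_bundle_carrier[OF assms(1,3)])
  show ?thesis
    by unfold_locales (use assms in \<open>auto simp: riemannian_metric_def\<close>)
qed

lemma vector_bundle_proj: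
  assumes "vector_bundle B E" "v \<in> topspace (total E)"
  shows "proj E v \<in> topspace B" "v \<in> fiber E (proj E v)"
  using assms continuous_map_image_subset_topspace[of "total E" B "proj E"]
  by (auto simp: vector_bundle_def fiber_def)

lemma fiberD: "v \<in> fiber E x \<Longrightarrow> v \<in> topspace (total E)" "v \<in> fiber E x \<Longrightarrow> proj E v = x"
  by (auto simp: fiber_def)

text \<open>The metric is continuous only on pairs of vectors over the same base point, so the two
  maps must have equal projections for the pairing to land in that subspace.\<close>

lemma continuous_map_riemannian_metric:
  assumes g: "riemannian_metric B E g"
    and a: "continuous_map T (total E) a" and b: "continuous_map T (total E) b"
    and ab: "\<And>t. t \<in> topspace T \<Longrightarrow> proj E (a t) = proj E (b t)"
  shows "continuous_map T euclideanreal (\<lambda>t. g (a t) (b t))"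
proof -
  have "continuous_map T
      (subtopology (prod_topology (total E) (total E)) {(v, w). proj E v = proj E w})
      (\<lambda>t. (a t, b t))"
    using a b ab by (auto simp: continuous_map_in_subtopology intro: continuous_map_pairedI)
  moreover have "continuous_map
      (subtopology (prod_topology (total E) (total E)) {(v, w). proj E v = proj E w})
      euclideanreal (\<lambda>(v, w). g v w)"
    using g by (simp add: riemannian_metric_def)
  ultimately show ?thesis
    using continuous_map_compose by (fastforce simp: o_def)
qed

lemma continuous_norm_metric_norm:
  assumes "vector_bundle B E" "riemannian_metric B E g"
  shows "continuous_norm B E (metric_norm g)"
proof -
  have "continuous_map (total E) euclideanreal (\<lambda>v. sqrt (g v v))"
    by (intro continuous_map_sqrt continuous_map_riemannian_metric[OF assms(2)]
        continuous_map_id[unfolded id_def]) auto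
  moreover have "norm_on (fiber E x) (vadd E) (vscale E) (vzero E x) (metric_norm g)"
    if "x \<in> topspace B" for x
    using riemannian_metric_carrier[OF assms that]
    by (rule inner_product_carrier.norm_on_metric_norm)
  ultimately show ?thesis
    by (auto simp: continuous_norm_def metric_norm_def[abs_def])
qed


subsection \<open>Adapted norms for iterates of an automorphism\<close>

lemma bundle_automorphism_funpow:
  assumes T: "bundle_automorphism B E f T" and x: "x \<in> topspace B"
  shows "(f ^^ k) x \<in> topspace B"
    and "v \<in> fiber E x \<Longrightarrow> (T ^^ k) v \<in> fiber E ((f ^^ k) x)"
    and "v \<in> fiber E x \<Longrightarrow> w \<in> fiber E x \<Longrightarrow>
      (T ^^ k) (vadd E v w) = vadd E ((T ^^ k) v) ((T ^^ k) w)"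
    and "v \<in> fiber E x \<Longrightarrow> (T ^^ k) (vscale E c v) = vscale E c ((T ^^ k) v)"
proof -
  have f: "f y \<in> topspace B" if "y \<in> topspace B" for y
    using T that homeomorphic_imp_surjective_map unfolding bundle_automorphism_def by blast
  then show base: "(f ^^ k) x \<in> topspace B" for k
    using x by (induction k) auto
  have "T v \<in> topspace (total E)" if "v \<in> topspace (total E)" for v
    using T that homeomorphic_imp_surjective_map unfolding bundle_automorphism_def by blast
  then have "T v \<in> fiber E (f y)" if "v \<in> fiber E y" for v y
    using T that unfolding bundle_automorphism_def fiber_def by auto
  then show mem: "(T ^^ k) v \<in> fiber E ((f ^^ k) x)" if "v \<in> fiber E x" for v k
    using that by (induction k) auto
  show "(T ^^ k) (vadd E v w) = vadd E ((T ^^ k) v) ((T ^^ k) w)"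
    if "v \<in> fiber E x" "w \<in> fiber E x"
  proof (induction k)
    case (Suc k)
    then show ?case
      using T base[of k] mem[OF that(1), of k] mem[OF that(2), of k]
      by (simp add: bundle_automorphism_def)
  qed simp
  show "(T ^^ k) (vscale E c v) = vscale E c ((T ^^ k) v)" if "v \<in> fiber E x"
  proof (induction k)
    case (Suc k)
    then show ?case
      using T base[of k] mem[OF that, of k] by (simp add: bundle_automorphism_def)
  qed simp
qed

lemma continuous_map_funpow: "continuous_map X X h \<Longrightarrow> continuous_map X X (h ^^ k)"
  by (induction k) (auto intro: continuous_map_compose)

text \<open>Definiteness comes from the term \<open>k = 0\<close>, a positive multiple of
  \<open>N\<close> itself, which is present because \<open>0 < m\<close>. The other terms only need
  to be seminorms on the fiber, and this follows from linearity of the iterates.\<close>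

lemma continuous_norm_weighted_sum:
  assumes E: "vector_bundle B E" and N: "continuous_norm B E N"
    and T: "bundle_automorphism B E f T" and a: "\<And>k. a k > 0" and m: "0 < m"
  shows "continuous_norm B E (\<lambda>v. \<Sum>k<m. a k * N ((T ^^ k) v))"
proof -
  have contT: "continuous_map (total E) (total E) (T ^^ k)" for k
    using T by (intro continuous_map_funpow)
      (simp add: bundle_automorphism_def homeomorphic_imp_continuous_map)
  have "continuous_map (total E) euclideanreal (\<lambda>v. N ((T ^^ k) v))" for k
    using continuous_map_compose[OF contT] N unfolding continuous_norm_def o_def by blast
  then have "continuous_map (total E) euclideanreal (\<lambda>v. \<Sum>k<m. a k * N ((T ^^ k) v))"
    by (intro continuous_map_sum continuous_map_real_mult_left) auto
  moreover have "norm_on (fiber E x) (vadd E) (vscale E) (vzero E x)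
      (\<lambda>v. \<Sum>k<m. a k * N ((T ^^ k) v))" if x: "x \<in> topspace B" for x
  proof -
    interpret real_vector_carrier "fiber E x" "vadd E" "vscale E" "vzero E x"
      by (rule vector_bundle_carrier[OF E x])
    note iter = bundle_automorphism_funpow[OF T x]
    have norm: "norm_on (fiber E ((f ^^ k) x)) (vadd E) (vscale E) (vzero E ((f ^^ k) x)) N" for k
      using N iter(1) by (simp add: continuous_norm_def)
    have nonneg: "0 \<le> a k * N ((T ^^ k) v)" if "v \<in> fiber E x" for k v
      using norm[of k] iter(2)[OF that, of k] a[of k] by (simp add: norm_on_def)
    have pos: "0 < (\<Sum>k<m. a k * N ((T ^^ k) v))" if v: "v \<in> fiber E x" "v \<noteq> vzero E x" for v
    proof (rule sum_pos2[of _ 0])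
      show "0 < a 0 * N ((T ^^ 0) v)"
        using norm[of 0] v a[of 0] unfolding norm_on_def
        by (metis eq_id_iff funpow_0 less_eq_real_def mult_pos_pos)
    qed (use m nonneg v in auto)
    have zero: "N ((T ^^ k) (vzero E x)) = 0" for k
    proof -
      \<comment> \<open>The zero vector is 0 times itself, and the iterate commutes with scaling, so
        homogeneity of \<open>N\<close> produces the factor 0.\<close>
      have "N ((T ^^ k) (vzero E x)) = \<bar>0\<bar> * N ((T ^^ k) (vzero E x))"
        using norm[of k] iter(2)[of "vzero E x" k] iter(4)[of "vzero E x" k 0]
        unfolding norm_on_def by (metis scl_zero_left zero_closed)
      then show ?thesis
        by simp
    qed
    show ?thesis
      unfolding norm_on_def
    proof (intro conjI ballI allI)
      fix v w assume v: "v \<in> fiber E x" and w: "w \<in> fiber E x"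
      have "a k * N ((T ^^ k) (vadd E v w)) \<le> a k * N ((T ^^ k) v) + a k * N ((T ^^ k) w)" for k
        using norm[of k] iter(2)[OF v, of k] iter(2)[OF w, of k] iter(3)[OF v w, of k] a[of k]
        by (simp add: norm_on_def flip: distrib_left)
      then show "(\<Sum>k<m. a k * N ((T ^^ k) (vadd E v w))) \<le>
          (\<Sum>k<m. a k * N ((T ^^ k) v)) + (\<Sum>k<m. a k * N ((T ^^ k) w))"
        by (simp add: sum_mono flip: sum.distrib)
    next
      fix c v assume v: "v \<in> fiber E x"
      have "a k * N ((T ^^ k) (vscale E c v)) = \<bar>c\<bar> * (a k * N ((T ^^ k) v))" for k
        using norm[of k] iter(2)[OF v, of k] iter(4)[OF v, of k c] by (simp add: norm_on_def)
      then show "(\<Sum>k<m. a k * N ((T ^^ k) (vscale E c v))) = \<bar>c\<bar> * (\<Sum>k<m. a k * N ((T ^^ k) v))"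
        unfolding sum_distrib_left by (intro sum.cong) auto
    next
      fix v assume v: "v \<in> fiber E x"
      show "0 \<le> (\<Sum>k<m. a k * N ((T ^^ k) v))"
        using nonneg[OF v] by (simp add: sum_nonneg)
      show "(\<Sum>k<m. a k * N ((T ^^ k) v)) = 0 \<longleftrightarrow> v = vzero E x"
        using pos[OF v] zero by force
    qed
  qed
  ultimately show ?thesis
    by (simp add: continuous_norm_def)
qed

text \<open>Stated for a general automorphism \<open>T\<close> and family \<open>F\<close>, so that
  it serves both \<open>A\<close> on \<open>Es\<close> and its inverse on \<open>Eu\<close>. The
  norm \<open>p\<close> lives on all of \<open>E\<close>, while contraction is claimed on
  \<open>F\<close> only. The bound \<open>N v \<le> p v\<close> is later the source of the lower
  equivalence constant.\<close>

lemma adapted_norm: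
  assumes E: "vector_bundle B E" and N: "continuous_norm B E N"
    and T: "bundle_automorphism B E f T"
    and F: "\<And>x. x \<in> topspace B \<Longrightarrow> F x \<subseteq> fiber E x"
    and l: "0 < l" "l < 1"
    and contr: "\<forall>n. \<forall>x\<in>topspace B. \<forall>v\<in>F x. N ((T ^^ n) v) \<le> C * l ^ n * N v"
  obtains p \<mu> where "continuous_norm B E p" "0 < \<mu>" "\<mu> < 1"
    "\<And>x v. x \<in> topspace B \<Longrightarrow> v \<in> F x \<Longrightarrow> p (T v) \<le> \<mu> * p v"
    "\<And>v. v \<in> topspace (total E) \<Longrightarrow> N v \<le> p v"
proof -
  \<comment> \<open>The midpoint is one choice strictly between \<open>l\<close> and 1: above
    \<open>l\<close> so that the powers of \<open>l / \<mu>\<close> tend to 0, below 1 so that \<mu>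
    is a contraction factor.\<close>
  define \<mu> where "\<mu> = (1 + l) / 2"
  have \<mu>: "0 < \<mu>" "\<mu> < 1" "l < \<mu>"
    using l by (auto simp: \<mu>_def)
  have "(\<lambda>n. C * (l / \<mu>) ^ n) \<longlonglongrightarrow> C * 0"
    using l \<mu> by (intro tendsto_mult tendsto_const LIMSEQ_power_zero) auto
  then have "\<forall>\<^sub>F n in sequentially. C * (l / \<mu>) ^ n < 1"
    by (rule order_tendstoD) simp
  then obtain m where m: "0 < m" "C * (l / \<mu>) ^ m < 1"
    using eventually_happens'[OF sequentially_bot eventually_conj[OF eventually_gt_at_top[of 0]]]
    by blast
  define p where "p = (\<lambda>v. \<Sum>k<m. inverse (\<mu> ^ k) * N ((T ^^ k) v))"
  have nonneg: "0 \<le> N ((T ^^ k) v)" if "v \<in> topspace (total E)" for k v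
    using N bundle_automorphism_funpow(1,2)[OF T vector_bundle_proj(1)[OF E that]]
      vector_bundle_proj(2)[OF E that]
    unfolding continuous_norm_def norm_on_def by blast
  show thesis
  proof
    show "continuous_norm B E p"
      unfolding p_def using \<mu> m by (intro continuous_norm_weighted_sum[OF E N T]) auto
    show "N v \<le> p v" if "v \<in> topspace (total E)" for v
    proof -
      have "inverse (\<mu> ^ 0) * N ((T ^^ 0) v) \<le> p v"
        unfolding p_def using m \<mu> nonneg[OF that] by (intro member_le_sum) auto
      then show ?thesis
        by simp
    qed
    show "p (T v) \<le> \<mu> * p v" if x: "x \<in> topspace B" and v: "v \<in> F x" for x v
    proof -
      have v0: "0 \<le> N v"
        using nonneg[of v 0] F[OF x] v fiberD by fastforce
      have "inverse (\<mu> ^ m) * N ((T ^^ m) v) \<le> inverse (\<mu> ^ m) * (C * l ^ m * N v)"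
        using contr x v \<mu> by (intro mult_left_mono) auto
      also have "\<dots> = C * (l / \<mu>) ^ m * N v"
        by (simp add: power_divide field_simps)
      also have "\<dots> \<le> N v"
        using m v0 mult_right_mono[of "C * (l / \<mu>) ^ m" 1 "N v"] by simp
      finally have last: "inverse (\<mu> ^ m) * N ((T ^^ m) v) \<le> N v" .
      \<comment> \<open>Applying \<open>T\<close> raises each exponent by one; pulling out one
        factor \<mu> restores the matching weight \<open>inverse (\<mu> ^ Suc k)\<close>.\<close>
      have "p (T v) = \<mu> * (\<Sum>k<m. inverse (\<mu> ^ Suc k) * N ((T ^^ Suc k) v))"
        using \<mu> by (simp add: p_def sum_distrib_left funpow_swap1 flip: mult.assoc)
      \<comment> \<open>The shifted sum runs over the indices 1 to \<open>m\<close>: compared with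
        \<open>p v\<close> it gains the term of index \<open>m\<close> and loses that of index 0,
        which is \<open>N v\<close>.\<close>
      also have "(\<Sum>k<m. inverse (\<mu> ^ Suc k) * N ((T ^^ Suc k) v)) =
          p v + inverse (\<mu> ^ m) * N ((T ^^ m) v) - N v"
        using sum.lessThan_Suc_shift[of "\<lambda>k. inverse (\<mu> ^ k) * N ((T ^^ k) v)" m]
        by (simp add: p_def)
      finally show ?thesis
        using last \<mu> by simp
    qed
  qed (use \<mu> in auto)
qed

text \<open>By injectivity, \<open>inv_into\<close> agrees on the target space with the continuous
  inverse supplied by the homeomorphism. This is the form needed for
  \<open>bundle_inv\<close>.\<close>

lemma homeomorphic_map_inv_into:
  assumes h: "homeomorphic_map X Y h"
  shows "homeomorphic_map Y X (inv_into (topspace X) h)"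
proof -
  obtain k where k: "homeomorphic_maps X Y h k"
    using h homeomorphic_map_maps by blast
  then have kYX: "homeomorphic_map Y X k"
    using homeomorphic_maps_map homeomorphic_maps_sym by blast
  have "k y = inv_into (topspace X) h y" if "y \<in> topspace Y" for y
  proof (rule inv_into_f_eq[symmetric])
    show "inj_on h (topspace X)"
      using h homeomorphic_imp_injective_map by blast
    show "k y \<in> topspace X" "h (k y) = y"
      using k that continuous_map_image_subset_topspace[of Y X k]
      by (auto simp: homeomorphic_maps_def)
  qed
  then show ?thesis
    using homeomorphic_map_eq[OF kYX] by blast
qed

text \<open>Each linearity identity for the inverse holds after applying \<open>A\<close>, and
  \<open>A\<close> is injective. With this the unstable bundle is treated as a stable one for the
  inverse.\<close>

lemma bundle_automorphism_bundle_inv: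
  assumes E: "vector_bundle B E" and A: "bundle_automorphism B E f A"
  shows "bundle_automorphism B E (inv_into (topspace B) f) (bundle_inv E A)"
proof -
  have f: "homeomorphic_map B B f" and AT: "homeomorphic_map (total E) (total E) A"
    and proj: "\<And>v. v \<in> topspace (total E) \<Longrightarrow> proj E (A v) = f (proj E v)"
    using A by (auto simp: bundle_automorphism_def)
  let ?I = "bundle_inv E A" and ?h = "inv_into (topspace B) f"
  have AI: "A (?I v) = v" "?I v \<in> topspace (total E)" if "v \<in> topspace (total E)" for v
    using AT that homeomorphic_imp_surjective_map[OF AT]
    by (auto simp: bundle_inv_def f_inv_into_f intro: inv_into_into)
  have IA: "?I (A v) = v" if "v \<in> topspace (total E)" for v
    using that homeomorphic_imp_injective_map[OF AT] by (simp add: bundle_inv_def)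
  have projI: "proj E (?I v) = ?h (proj E v)" if "v \<in> topspace (total E)" for v
  proof -
    have "?h (f (proj E (?I v))) = proj E (?I v)"
      using homeomorphic_imp_injective_map[OF f] vector_bundle_proj(1)[OF E AI(2)[OF that]]
      by (rule inv_into_f_f)
    then show ?thesis
      using proj[OF AI(2)[OF that]] AI(1)[OF that] by simp
  qed
  have memI: "?I v \<in> fiber E (?h x)" if "v \<in> fiber E x" for v x
    using AI projI that by (auto simp: fiber_def)
  have hx: "?h x \<in> topspace B" if "x \<in> topspace B" for x
    using that homeomorphic_imp_surjective_map[OF f] by (auto intro: inv_into_into)
  have "?I (vadd E v w) = vadd E (?I v) (?I w)"
    if "x \<in> topspace B" "v \<in> fiber E x" "w \<in> fiber E x" for x v w
  proof -
    interpret real_vector_carrier "fiber E (?h x)" "vadd E" "vscale E" "vzero E (?h x)"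
      by (rule vector_bundle_carrier[OF E hx[OF that(1)]])
    have "A (vadd E (?I v) (?I w)) = vadd E (A (?I v)) (A (?I w))"
      using A memI[OF that(2)] memI[OF that(3)] hx[OF that(1)]
      by (simp add: bundle_automorphism_def)
    also have "\<dots> = vadd E v w"
      using that by (simp add: AI fiberD)
    finally show ?thesis
      using IA[of "vadd E (?I v) (?I w)"] memI[OF that(2)] memI[OF that(3)] fiberD(1) add_closed
      by fastforce
  qed
  moreover have "?I (vscale E c v) = vscale E c (?I v)"
    if "x \<in> topspace B" "v \<in> fiber E x" for x c v
  proof -
    interpret real_vector_carrier "fiber E (?h x)" "vadd E" "vscale E" "vzero E (?h x)"
      by (rule vector_bundle_carrier[OF E hx[OF that(1)]])
    have "A (vscale E c (?I v)) = vscale E c (A (?I v))"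
      using A memI[OF that(2)] hx[OF that(1)] by (simp add: bundle_automorphism_def)
    also have "\<dots> = vscale E c v"
      using that by (simp add: AI fiberD)
    finally show ?thesis
      using IA[of "vscale E c (?I v)"] memI[OF that(2)] fiberD(1) scl_closed by fastforce
  qed
  moreover have "homeomorphic_map (total E) (total E) ?I"
    unfolding bundle_inv_def by (rule homeomorphic_map_inv_into[OF AT])
  ultimately show ?thesis
    using homeomorphic_map_inv_into[OF f] projI by (auto simp: bundle_automorphism_def)
qed


subsection \<open>Subbundles and splittings\<close>

lemma subbundleD:
  assumes "subbundle B E F" "x \<in> topspace B"
  shows "v \<in> F x \<Longrightarrow> v \<in> fiber E x" "vzero E x \<in> F x"
    "v \<in> F x \<Longrightarrow> w \<in> F x \<Longrightarrow> vadd E v w \<in> F x" "v \<in> F x \<Longrightarrow> vscale E c v \<in> F x"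
  using assms by (auto simp: subbundle_def subspace_on_def)

text \<open>A local trivialization of a subbundle, read in the direction from \<open>\<real>\<^sup>n\<close> to the fibers.\<close>

definition subbundle_chart ::
  "'x topology \<Rightarrow> ('x, 'e) bundle_data \<Rightarrow> ('x \<Rightarrow> 'e set) \<Rightarrow> 'x set \<Rightarrow> nat \<Rightarrow>
    ('x \<times> (nat \<Rightarrow> real) \<Rightarrow> 'e) \<Rightarrow> bool"
  where "subbundle_chart B E F U n \<psi> \<longleftrightarrow> openin B U \<and>
    continuous_map (prod_topology (subtopology B U) (Euclidean_space n)) (total E) \<psi> \<and>
    (\<forall>x\<in>U. \<forall>a\<in>topspace (Euclidean_space n).
      \<psi> (x, a) \<in> F x \<and> (\<forall>c. \<psi> (x, \<lambda>i. c * a i) = vscale E c (\<psi> (x, a))) \<and>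
      (\<psi> (x, a) = vzero E x \<longrightarrow> a = (\<lambda>i. 0))) \<and>
    (\<forall>x\<in>U. \<forall>v\<in>F x. \<exists>a\<in>topspace (Euclidean_space n). v = \<psi> (x, a))"

lemma subbundle_chartD:
  assumes "subbundle_chart B E F U n \<psi>"
  shows "openin B U"
    "continuous_map (prod_topology (subtopology B U) (Euclidean_space n)) (total E) \<psi>"
    "\<And>x a. x \<in> U \<Longrightarrow> a \<in> topspace (Euclidean_space n) \<Longrightarrow> \<psi> (x, a) \<in> F x"
    "\<And>x a c. x \<in> U \<Longrightarrow> a \<in> topspace (Euclidean_space n) \<Longrightarrow>
      \<psi> (x, \<lambda>i. c * a i) = vscale E c (\<psi> (x, a))"
    "\<And>x a. x \<in> U \<Longrightarrow> a \<in> topspace (Euclidean_space n) \<Longrightarrow> \<psi> (x, a) = vzero E x \<Longrightarrow>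
      a = (\<lambda>i. 0)"
    "\<And>x v. x \<in> U \<Longrightarrow> v \<in> F x \<Longrightarrow> \<exists>a\<in>topspace (Euclidean_space n). v = \<psi> (x, a)"
  using assms unfolding subbundle_chart_def by metis+

text \<open>The chart is the inverse of a local trivialization of the restricted bundle. Linearity
  is given for the trivialization \<phi> alone, so identities for \<psi> are checked by comparing
  images under \<phi>.\<close>

lemma subbundle_chart_exists:
  assumes E: "vector_bundle B E" and F: "subbundle B E F" and x0: "x0 \<in> topspace B"
  obtains U n \<psi> where "subbundle_chart B E F U n \<psi>" "x0 \<in> U"
proof -
  let ?R = "restrict_bundle B E F"
  have R: "vector_bundle B ?R"
    using F by (simp add: subbundle_def)
  have topR: "topspace (total ?R) = (\<Union>x\<in>topspace B. F x)"
    using subbundleD(1)[OF F] by (auto simp: restrict_bundle_def fiber_def)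
  have proj: "proj E v = x" if "x \<in> topspace B" "v \<in> F x" for x v
    using subbundleD(1)[OF F that] by (simp add: fiberD)
  have projR: "proj ?R = proj E"
    by (simp add: restrict_bundle_def)
  have fibR: "fiber ?R x = F x" if "x \<in> topspace B" for x
    unfolding fiber_def topR projR using proj that by fastforce
  obtain U n \<phi> where U: "openin B U" "x0 \<in> U" and triv: "local_trivialization B ?R U n \<phi>"
    using R x0 unfolding vector_bundle_def by blast
  have UB: "x \<in> topspace B" if "x \<in> U" for x
    using U(1) that openin_subset by blast
  let ?S = "subtopology (total ?R) {v \<in> topspace (total ?R). proj ?R v \<in> U}"
  let ?P = "prod_topology (subtopology B U) (Euclidean_space n)"
  have topS: "topspace ?S = {v \<in> topspace (total ?R). proj E v \<in> U}"
    by (auto simp: projR)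
  have topP: "topspace ?P = U \<times> topspace (Euclidean_space n)"
    using UB by auto
  have hom: "homeomorphic_map ?S ?P \<phi>"
    using triv by (simp add: local_trivialization_def)
  then obtain \<psi> where \<psi>: "homeomorphic_maps ?S ?P \<phi> \<psi>"
    using homeomorphic_map_maps by blast
  have fst\<phi>: "fst (\<phi> v) = x" if "x \<in> U" "v \<in> F x" for x v
    using triv that fibR[OF UB] unfolding local_trivialization_def by blast
  have snd\<phi>: "snd (\<phi> (vscale E c v)) = (\<lambda>i. c * snd (\<phi> v) i)" if "x \<in> U" "v \<in> F x" for x v c
    using triv that fibR[OF UB[OF that(1)]]
    by (auto simp: local_trivialization_def restrict_bundle_def)
  have \<psi>S: "\<psi> y \<in> topspace ?S" if "y \<in> topspace ?P" for y
    using \<psi> that continuous_map_image_subset_topspace[of ?P ?S \<psi>]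
    unfolding homeomorphic_maps_def by blast
  have \<phi>\<psi>: "\<phi> (\<psi> y) = y" if "y \<in> topspace ?P" for y
    using \<psi> that unfolding homeomorphic_maps_def by blast
  have FS: "v \<in> topspace ?S" if "x \<in> U" "v \<in> F x" for x v
    using that UB[OF that(1)] proj[OF UB[OF that(1)] that(2)] by (auto simp: topR projR)
  have \<psi>\<phi>: "\<psi> (\<phi> v) = v" if "x \<in> U" "v \<in> F x" for x v
    using \<psi> FS[OF that] unfolding homeomorphic_maps_def by blast
  have \<phi>P: "\<phi> v \<in> topspace ?P" if "x \<in> U" "v \<in> F x" for x v
    using \<psi> FS[OF that] continuous_map_image_subset_topspace[of ?S ?P \<phi>]
    unfolding homeomorphic_maps_def by blast
  have \<psi>F: "\<psi> (x, a) \<in> F x" if "x \<in> U" "a \<in> topspace (Euclidean_space n)" for x a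
  proof -
    have "\<psi> (x, a) \<in> topspace ?S"
      using \<psi>S topP that by blast
    \<comment> \<open>The point lies a priori in some fiber \<open>F y\<close>; the first coordinate
      of \<phi> then forces \<open>y = x\<close>.\<close>
    then obtain y where y: "y \<in> U" "\<psi> (x, a) \<in> F y"
      using proj by (auto simp: topR projR)
    then have "fst (\<phi> (\<psi> (x, a))) = y"
      by (rule fst\<phi>)
    then show ?thesis
      using \<phi>\<psi>[of "(x, a)"] that UB[OF that(1)] y by simp
  qed
  have snd\<psi>: "snd (\<phi> (\<psi> (x, a))) = a" if "x \<in> U" "a \<in> topspace (Euclidean_space n)" for x a
    using \<phi>\<psi>[of "(x, a)"] that UB[OF that(1)] by simp
  have "subbundle_chart B E F U n \<psi>"
    unfolding subbundle_chart_def
  proof (intro conjI ballI allI impI)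
    show "continuous_map ?P (total E) \<psi>"
    proof -
      have "continuous_map ?P ?S \<psi>"
        using \<psi> by (simp add: homeomorphic_maps_def)
      then show ?thesis
        by (simp add: continuous_map_in_subtopology restrict_bundle_def)
    qed
    show "\<exists>a\<in>topspace (Euclidean_space n). v = \<psi> (x, a)" if "x \<in> U" "v \<in> F x" for x v
    proof
      show "v = \<psi> (x, snd (\<phi> v))"
        using \<psi>\<phi>[OF that] fst\<phi>[OF that] by (metis prod.collapse)
      show "snd (\<phi> v) \<in> topspace (Euclidean_space n)"
        using \<phi>P[OF that] unfolding topP by (simp add: mem_Times_iff)
    qed
    show "\<psi> (x, \<lambda>i. c * a i) = vscale E c (\<psi> (x, a))"
      if "x \<in> U" "a \<in> topspace (Euclidean_space n)" for x a c
    proof -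
      let ?v = "vscale E c (\<psi> (x, a))"
      have v: "?v \<in> F x"
        using \<psi>F[OF that] subbundleD(4)[OF F UB[OF that(1)]] by blast
      have "\<phi> ?v = (x, \<lambda>i. c * a i)"
        using fst\<phi>[OF that(1) v] snd\<phi>[OF that(1) \<psi>F[OF that]] snd\<psi>[OF that]
        by (simp add: prod_eq_iff)
      then show ?thesis
        using \<psi>\<phi>[OF that(1) v] by simp
    qed
    show "a = (\<lambda>i. 0)"
      if x: "x \<in> U" and a: "a \<in> topspace (Euclidean_space n)" and z: "\<psi> (x, a) = vzero E x" for x a
    proof -
      interpret real_vector_carrier "fiber E x" "vadd E" "vscale E" "vzero E x"
        by (rule vector_bundle_carrier[OF E UB[OF x]])
      \<comment> \<open>Writing the zero vector as 0 times itself lets homogeneity of \<phi> show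
        that its coordinates vanish.\<close>
      have "a = snd (\<phi> (vscale E 0 (vzero E x)))"
        using snd\<psi>[OF x a] z by simp
      also have "\<dots> = (\<lambda>i. 0 * snd (\<phi> (vzero E x)) i)"
        using snd\<phi>[OF x \<psi>F[OF x a]] unfolding z by blast
      finally show ?thesis
        by simp
    qed
  qed (use U \<psi>F in auto)
  then show thesis
    using that U by blast
qed

lemma continuous_splittingD:
  assumes "continuous_splitting B E F G"
  shows "subbundle B E F" "subbundle B E G"
  using assms by (auto simp: continuous_splitting_def)

lemma continuous_splitting_ex:
  assumes "continuous_splitting B E F G" "x \<in> topspace B" "v \<in> fiber E x"
  obtains s u where "s \<in> F x" "u \<in> G x" "v = vadd E s u"
  using assms unfolding continuous_splitting_def by (metis SigmaE fst_conv snd_conv)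

lemma continuous_splitting_unique:
  assumes E: "vector_bundle B E" and FG: "continuous_splitting B E F G" and x: "x \<in> topspace B"
    and "s \<in> F x" "u \<in> G x" "s' \<in> F x" "u' \<in> G x" "vadd E s u = vadd E s' u'"
  shows "s = s' \<and> u = u'"
proof -
  interpret real_vector_carrier "fiber E x" "vadd E" "vscale E" "vzero E x"
    by (rule vector_bundle_carrier[OF E x])
  have "vadd E s u \<in> fiber E x"
    using assms subbundleD(1)[OF continuous_splittingD(1)[OF FG] x]
      subbundleD(1)[OF continuous_splittingD(2)[OF FG] x] by simp
  then have "\<exists>!p. p \<in> F x \<times> G x \<and> vadd E s u = vadd E (fst p) (snd p)"
    using FG x unfolding continuous_splitting_def by blast
  then have "(s, u) = (s', u')"
    by (rule ex1E) (use assms in \<open>metis (no_types, lifting) SigmaI fst_conv snd_conv\<close>)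
  then show ?thesis
    by simp
qed

text \<open>By this symmetry, whatever is proved for the component in \<open>F\<close> applies to
  the component in \<open>G\<close>.\<close>

lemma continuous_splitting_commute:
  assumes E: "vector_bundle B E" and FG: "continuous_splitting B E F G"
  shows "continuous_splitting B E G F"
  unfolding continuous_splitting_def
proof (intro conjI ballI)
  fix x v assume x: "x \<in> topspace B" and v: "v \<in> fiber E x"
  interpret real_vector_carrier "fiber E x" "vadd E" "vscale E" "vzero E x"
    by (rule vector_bundle_carrier[OF E x])
  note F = subbundleD(1)[OF continuous_splittingD(1)[OF FG] x]
    and G = subbundleD(1)[OF continuous_splittingD(2)[OF FG] x]
  obtain s u where su: "s \<in> F x" "u \<in> G x" "v = vadd E s u"
    using continuous_splitting_ex[OF FG x v] by blast
  show "\<exists>!p. p \<in> G x \<times> F x \<and> v = vadd E (fst p) (snd p)"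
  proof (rule ex1I[of _ "(u, s)"])
    show "(u, s) \<in> G x \<times> F x \<and> v = vadd E (fst (u, s)) (snd (u, s))"
      using su add_commute[OF F G] by auto
    fix p assume "p \<in> G x \<times> F x \<and> v = vadd E (fst p) (snd p)"
    then have p: "fst p \<in> G x" "snd p \<in> F x" "v = vadd E (snd p) (fst p)"
      using add_commute[OF F G] by (auto simp: mem_Times_iff)
    then show "p = (u, s)"
      using continuous_splitting_unique[OF E FG x su(1,2) p(2,1)] su(3) by (simp add: prod_eq_iff)
  qed
qed (use continuous_splittingD[OF FG] in auto)


subsection \<open>Domination by the metric\<close>

lemma continuous_map_Euclidean_space_coordinate:
  "continuous_map (Euclidean_space n) euclideanreal (\<lambda>a. a i)"
  unfolding Euclidean_space_def
  by (intro continuous_map_from_subtopology continuous_map_product_coordinates) simp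

text \<open>As a set of functions on all of \<open>nat\<close>, the cube is a product of intervals
  for \<open>i < n\<close> and singletons \<open>{0}\<close> beyond, so Tychonoff's theorem
  applies.\<close>

lemma compactin_Euclidean_space_cube:
  "compactin (Euclidean_space n) {a \<in> topspace (Euclidean_space n). \<forall>i<n. \<bar>a i\<bar> \<le> 1}"
proof -
  have "{a \<in> topspace (Euclidean_space n). \<forall>i<n. \<bar>a i\<bar> \<le> 1} =
      (\<Pi>\<^sub>E i\<in>UNIV. if i < n then {-1..1::real} else {0})"
    by (force simp: topspace_Euclidean_space PiE_iff abs_le_iff split: if_splits)
  moreover have "compactin (powertop_real UNIV) (\<Pi>\<^sub>E i\<in>UNIV. if i < n then {-1..1::real} else {0})"
    by (subst compactin_PiE) auto
  ultimately show ?thesis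
    unfolding Euclidean_space_def by (auto simp: compactin_subtopology)
qed

text \<open>The unit sphere of the l1 norm on pairs, closed inside a product of two cubes.
  Normalising \<open>a\<close> and \<open>b\<close> jointly fits sums \<open>s + u\<close> in which
  one summand, but not both, may vanish.\<close>

lemma compactin_Euclidean_space_sphere:
  "compactin (prod_topology (Euclidean_space k) (Euclidean_space l))
    {(a, b). a \<in> topspace (Euclidean_space k) \<and> b \<in> topspace (Euclidean_space l) \<and>
      (\<Sum>i<k. \<bar>a i\<bar>) + (\<Sum>j<l. \<bar>b j\<bar>) = 1}"
  (is "compactin ?P ?K")
proof (rule closed_compactin)
  let ?Q = "\<lambda>n. {a \<in> topspace (Euclidean_space n). \<forall>i<n. \<bar>a i\<bar> \<le> 1}"
  show "compactin ?P (?Q k \<times> ?Q l)"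
    unfolding compactin_Times using compactin_Euclidean_space_cube by blast
  show "?K \<subseteq> ?Q k \<times> ?Q l"
  proof clarsimp
    fix a b :: "nat \<Rightarrow> real"
    assume 1: "(\<Sum>i<k. \<bar>a i\<bar>) + (\<Sum>j<l. \<bar>b j\<bar>) = 1"
    have "\<bar>a i\<bar> \<le> (\<Sum>i<k. \<bar>a i\<bar>)" if "i < k" for i
      using that by (intro member_le_sum) auto
    moreover have "\<bar>b j\<bar> \<le> (\<Sum>j<l. \<bar>b j\<bar>)" if "j < l" for j
      using that by (intro member_le_sum) auto
    moreover have "(\<Sum>i<k. \<bar>a i\<bar>) \<ge> 0" "(\<Sum>j<l. \<bar>b j\<bar>) \<ge> 0"
      by (auto intro: sum_nonneg)
    ultimately show "(\<forall>i<k. \<bar>a i\<bar> \<le> 1) \<and> (\<forall>j<l. \<bar>b j\<bar> \<le> 1)"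
      using 1 by force
  qed
  have "continuous_map ?P euclideanreal (\<lambda>y. fst y i)" "continuous_map ?P euclideanreal (\<lambda>y. snd y i)"
    for i
    using continuous_map_compose[OF continuous_map_fst continuous_map_Euclidean_space_coordinate]
      continuous_map_compose[OF continuous_map_snd continuous_map_Euclidean_space_coordinate]
    by (auto simp: o_def)
  then have "continuous_map ?P euclideanreal (\<lambda>y. (\<Sum>i<k. \<bar>fst y i\<bar>) + (\<Sum>j<l. \<bar>snd y j\<bar>))"
    by (intro continuous_intros) auto
  from closedin_continuous_map_preimage[OF this, of "{1}"]
  have "closedin ?P {y \<in> topspace ?P. (\<Sum>i<k. \<bar>fst y i\<bar>) + (\<Sum>j<l. \<bar>snd y j\<bar>) \<in> {1}}"
    by simp
  also have "{y \<in> topspace ?P. (\<Sum>i<k. \<bar>fst y i\<bar>) + (\<Sum>j<l. \<bar>snd y j\<bar>) \<in> {1}} = ?K"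
    by auto
  finally show "closedin ?P ?K" .
qed

text \<open>A form of the tube lemma: projection along a compact factor is a closed map, so the base
  points over which \<open>h\<close> becomes large form a closed set.\<close>

lemma continuous_map_locally_bounded_along_compact:
  assumes K: "compact_space K" and h: "continuous_map (prod_topology X K) euclideanreal h"
    and x0: "x0 \<in> topspace X"
  obtains O' M where "openin X O'" "x0 \<in> O'"
    "\<forall>x\<in>O'. \<forall>y\<in>topspace K. h (x, y) \<le> (M::real)"
proof -
  let ?P = "prod_topology X K"
  have "compactin ?P ({x0} \<times> topspace K)"
    using K x0 by (auto simp: compactin_Times compact_space_def)
  then have "compact (h ` ({x0} \<times> topspace K))"
    using image_compactin[OF _ h] by fastforce
  then obtain M0 where "\<forall>r \<in> h ` ({x0} \<times> topspace K). \<bar>r\<bar> \<le> M0"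
    using compact_imp_bounded bounded_real by blast
  then have M0: "h (x0, y) \<le> M0" if "y \<in> topspace K" for y
    using that by force
  \<comment> \<open>The added 1 keeps \<open>x0\<close> off the projection of \<open>?C\<close>,
    since \<open>h\<close> is at most \<open>M0\<close> over \<open>x0\<close>.\<close>
  let ?C = "{t \<in> topspace ?P. h t \<in> {M0 + 1..}}"
  have "closedin ?P ?C"
    by (rule closedin_continuous_map_preimage[OF h]) simp
  then have C: "closedin X (fst ` ?C)"
    using Abstract_Topological_Spaces.closed_map_fst[OF K] unfolding closed_map_def by blast
  show thesis
  proof
    show "openin X (topspace X - fst ` ?C)"
      using C by blast
    show "x0 \<in> topspace X - fst ` ?C"
      using x0 M0 by force
    show "\<forall>x\<in>topspace X - fst ` ?C. \<forall>y\<in>topspace K. h (x, y) \<le> M0 + 1"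
    proof (intro ballI, rule ccontr)
      fix x y assume that: "x \<in> topspace X - fst ` ?C" "y \<in> topspace K"
      assume "\<not> h (x, y) \<le> M0 + 1"
      then have "(x, y) \<in> ?C"
        using that by auto
      then show False
        using that image_iff by fastforce
    qed
  qed
qed

text \<open>The metric is positive on the compact spheres of \<open>F \<oplus> G\<close>; continuity of the addition of
  \<open>E\<close> is avoided by expanding the metric bilinearly.\<close>

lemma splitting_dominated_locally:
  assumes E: "vector_bundle B E" and g: "riemannian_metric B E g"
    and FG: "continuous_splitting B E F G" and p: "continuous_norm B E p"
    and x0: "x0 \<in> topspace B"
  obtains W M where "openin B W" "x0 \<in> W"
    "\<And>x s u. x \<in> W \<Longrightarrow> s \<in> F x \<Longrightarrow> u \<in> G x \<Longrightarrow> p s \<le> M * metric_norm g (vadd E s u)"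
proof -
  note F = continuous_splittingD(1)[OF FG] and G = continuous_splittingD(2)[OF FG]
  obtain U k \<psi> where \<psi>_chart: "subbundle_chart B E F U k \<psi>" and xU: "x0 \<in> U"
    using subbundle_chart_exists[OF E F x0] .
  obtain V l \<xi> where \<xi>_chart: "subbundle_chart B E G V l \<xi>" and xV: "x0 \<in> V"
    using subbundle_chart_exists[OF E G x0] .
  note U = subbundle_chartD(1)[OF \<psi>_chart] xU and V = subbundle_chartD(1)[OF \<xi>_chart] xV
  note \<psi> = subbundle_chartD(2)[OF \<psi>_chart] and \<psi>F = subbundle_chartD(3)[OF \<psi>_chart]
    and \<psi>scale = subbundle_chartD(4)[OF \<psi>_chart] and \<psi>0 = subbundle_chartD(5)[OF \<psi>_chart]
    and \<psi>surj = subbundle_chartD(6)[OF \<psi>_chart]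
  note \<xi> = subbundle_chartD(2)[OF \<xi>_chart] and \<xi>G = subbundle_chartD(3)[OF \<xi>_chart]
    and \<xi>scale = subbundle_chartD(4)[OF \<xi>_chart] and \<xi>0 = subbundle_chartD(5)[OF \<xi>_chart]
    and \<xi>surj = subbundle_chartD(6)[OF \<xi>_chart]
  define K where "K = {(a, b). a \<in> topspace (Euclidean_space k) \<and>
    b \<in> topspace (Euclidean_space l) \<and> (\<Sum>i<k. \<bar>a i\<bar>) + (\<Sum>j<l. \<bar>b j\<bar>) = 1}"
  let ?E2 = "prod_topology (Euclidean_space k) (Euclidean_space l)"
  let ?W = "U \<inter> V"
  let ?P = "prod_topology (subtopology B ?W) (subtopology ?E2 K)"
  have W: "openin B ?W" "x0 \<in> ?W"
    using U V by auto
  have WB: "x \<in> topspace B" if "x \<in> ?W" for x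
    using that U(1) openin_subset by blast
  have topK: "topspace (subtopology ?E2 K) = K"
    by (auto simp: K_def)
  have compK: "compact_space (subtopology ?E2 K)"
    using compactin_Euclidean_space_sphere[of k l] unfolding K_def compactin_subspace by blast
  define \<alpha> where "\<alpha> = (\<lambda>t :: _ \<times> _ \<times> (nat \<Rightarrow> real). \<psi> (fst t, fst (snd t)))"
  define \<beta> where "\<beta> = (\<lambda>t :: _ \<times> (nat \<Rightarrow> real) \<times> _. \<xi> (fst t, snd (snd t)))"
  have \<alpha>F: "\<alpha> t \<in> F (fst t)" and \<beta>G: "\<beta> t \<in> G (fst t)" and tW: "fst t \<in> ?W"
    if "t \<in> topspace ?P" for t
    using that \<psi>F \<xi>G by (auto simp: \<alpha>_def \<beta>_def K_def)
  have fst\<^sub>P: "continuous_map ?P (subtopology B U) fst" "continuous_map ?P (subtopology B V) fst"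
    using continuous_map_fst[of "subtopology B ?W" "subtopology ?E2 K"]
    by (auto simp: continuous_map_in_subtopology)
  have snd\<^sub>P: "continuous_map ?P ?E2 snd"
    using continuous_map_snd[of "subtopology B ?W" "subtopology ?E2 K"]
    by (simp add: continuous_map_in_subtopology)
  have cont\<alpha>: "continuous_map ?P (total E) \<alpha>"
  proof -
    have "continuous_map ?P (prod_topology (subtopology B U) (Euclidean_space k))
        (\<lambda>t. (fst t, fst (snd t)))"
      using fst\<^sub>P continuous_map_fst_of[OF snd\<^sub>P] by (intro continuous_map_pairedI) (auto simp: o_def)
    from continuous_map_compose[OF this \<psi>] show ?thesis
      by (simp add: \<alpha>_def o_def)
  qed
  have cont\<beta>: "continuous_map ?P (total E) \<beta>"
  proof -
    have "continuous_map ?P (prod_topology (subtopology B V) (Euclidean_space l))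
        (\<lambda>t. (fst t, snd (snd t)))"
      using fst\<^sub>P continuous_map_snd_of[OF snd\<^sub>P] by (intro continuous_map_pairedI) (auto simp: o_def)
    from continuous_map_compose[OF this \<xi>] show ?thesis
      by (simp add: \<beta>_def o_def)
  qed
  have fib\<alpha>: "\<alpha> t \<in> fiber E (fst t)" and fib\<beta>: "\<beta> t \<in> fiber E (fst t)" if "t \<in> topspace ?P" for t
    using subbundleD(1)[OF F WB[OF tW[OF that]] \<alpha>F[OF that]]
      subbundleD(1)[OF G WB[OF tW[OF that]] \<beta>G[OF that]] by auto
  define h where "h = (\<lambda>t. sqrt (g (\<alpha> t) (\<alpha> t) + 2 * g (\<alpha> t) (\<beta> t) + g (\<beta> t) (\<beta> t)))"
  have h_eq: "h t = metric_norm g (vadd E (\<alpha> t) (\<beta> t))" if t: "t \<in> topspace ?P" for t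
  proof -
    interpret inner_product_carrier "fiber E (fst t)" "vadd E" "vscale E" "vzero E (fst t)" g
      by (rule riemannian_metric_carrier[OF E g WB[OF tW[OF t]]])
    show ?thesis
      using fib\<alpha>[OF t] fib\<beta>[OF t] inner_commute[of "\<beta> t" "\<alpha> t"]
      by (simp add: h_def metric_norm_def inner_expand)
  qed
  have conth: "continuous_map ?P euclideanreal h"
    unfolding h_def using cont\<alpha> cont\<beta> fib\<alpha> fib\<beta>
    by (intro continuous_map_sqrt continuous_map_add continuous_map_real_mult_left
        continuous_map_riemannian_metric[OF g]) (auto simp: fiber_def)
  have hpos: "0 < h t" if t: "t \<in> topspace ?P" for t
  proof -
    let ?x = "fst t"
    note xB = WB[OF tW[OF t]]
    interpret inner_product_carrier "fiber E ?x" "vadd E" "vscale E" "vzero E ?x" g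
      by (rule riemannian_metric_carrier[OF E g xB])
    \<comment> \<open>By uniqueness of the splitting a vanishing sum has vanishing summands; then
      all coordinates are 0, against their l1 norm being 1.\<close>
    have "vadd E (\<alpha> t) (\<beta> t) \<noteq> vzero E ?x"
    proof
      assume "vadd E (\<alpha> t) (\<beta> t) = vzero E ?x"
      then have "vadd E (\<alpha> t) (\<beta> t) = vadd E (vzero E ?x) (vzero E ?x)"
        by simp
      then have "\<alpha> t = vzero E ?x \<and> \<beta> t = vzero E ?x"
        by (rule continuous_splitting_unique[OF E FG xB \<alpha>F[OF t] \<beta>G[OF t]
            subbundleD(2)[OF F xB] subbundleD(2)[OF G xB]])
      then have zero: "\<psi> (?x, fst (snd t)) = vzero E ?x" "\<xi> (?x, snd (snd t)) = vzero E ?x"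
        by (simp_all add: \<alpha>_def \<beta>_def)
      have "snd t \<in> K"
        using t by (simp add: mem_Times_iff)
      then have mem: "fst (snd t) \<in> topspace (Euclidean_space k)"
          "snd (snd t) \<in> topspace (Euclidean_space l)"
        and 1: "(\<Sum>i<k. \<bar>fst (snd t) i\<bar>) + (\<Sum>j<l. \<bar>snd (snd t) j\<bar>) = 1"
        by (simp_all add: K_def split_beta)
      have "fst (snd t) = (\<lambda>i. 0)" "snd (snd t) = (\<lambda>i. 0)"
        using \<psi>0[OF _ mem(1) zero(1)] \<xi>0[OF _ mem(2) zero(2)] tW[OF t] by simp_all
      then show False
        using 1 by simp
    qed
    then show ?thesis
      using fib\<alpha>[OF t] fib\<beta>[OF t] inner_pos by (simp add: h_eq[OF t] metric_norm_def)
  qed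
  have "continuous_map (total E) euclideanreal p"
    using p by (simp add: continuous_norm_def)
  then have "continuous_map ?P euclideanreal (\<lambda>t. p (\<alpha> t))"
    using continuous_map_compose[OF cont\<alpha>] by (simp add: o_def)
  then have quot: "continuous_map ?P euclideanreal (\<lambda>t. p (\<alpha> t) / h t)"
    by (rule continuous_map_real_divide[OF _ conth]) (use hpos in \<open>metis less_irrefl\<close>)
  have x0W: "x0 \<in> topspace (subtopology B ?W)"
    using x0 W(2) by simp
  obtain O' M where O': "openin (subtopology B ?W) O'" "x0 \<in> O'"
    and M: "\<forall>x\<in>O'. \<forall>y\<in>topspace (subtopology ?E2 K). p (\<alpha> (x, y)) / h (x, y) \<le> M"
    by (rule continuous_map_locally_bounded_along_compact[OF compK quot x0W])
  have O'W: "O' \<subseteq> ?W" "openin B O'"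
    using O' W openin_open_subtopology by blast+
  show thesis
  proof
    show "openin B O'" "x0 \<in> O'"
      by fact+
    fix x s u assume x: "x \<in> O'" and s: "s \<in> F x" and u: "u \<in> G x"
    have xW: "x \<in> U" "x \<in> V" and xB: "x \<in> topspace B"
      using x O'W WB by auto
    interpret inner_product_carrier "fiber E x" "vadd E" "vscale E" "vzero E x" g
      by (rule riemannian_metric_carrier[OF E g xB])
    have norms: "norm_on (fiber E x) (vadd E) (vscale E) (vzero E x) p"
      using p xB by (simp add: continuous_norm_def)
    have sE: "s \<in> fiber E x" and uE: "u \<in> fiber E x"
      using subbundleD(1)[OF F xB s] subbundleD(1)[OF G xB u] .
    obtain a where a: "a \<in> topspace (Euclidean_space k)" "s = \<psi> (x, a)"
      using \<psi>surj[OF xW(1) s] by blast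
    obtain b where b: "b \<in> topspace (Euclidean_space l)" "u = \<xi> (x, b)"
      using \<xi>surj[OF xW(2) u] by blast
    define r where "r = (\<Sum>i<k. \<bar>a i\<bar>) + (\<Sum>j<l. \<bar>b j\<bar>)"
    have r0: "0 \<le> (\<Sum>i<k. \<bar>a i\<bar>)" "0 \<le> (\<Sum>j<l. \<bar>b j\<bar>)"
      by (auto intro: sum_nonneg)
    show "p s \<le> M * metric_norm g (vadd E s u)"
    proof (cases "r = 0")
      case True
      then have sums: "(\<Sum>i<k. \<bar>a i\<bar>) = 0" "(\<Sum>j<l. \<bar>b j\<bar>) = 0"
        using r0 unfolding r_def by linarith+
      have "a = (\<lambda>i. 0)" "b = (\<lambda>i. 0)"
      proof -
        have "a i = 0" for i
          using sums(1) a(1)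
          by (cases "i < k") (simp_all add: sum_nonneg_eq_0_iff topspace_Euclidean_space)
        then show "a = (\<lambda>i. 0)"
          by (rule ext)
        have "b i = 0" for i
          using sums(2) b(1)
          by (cases "i < l") (simp_all add: sum_nonneg_eq_0_iff topspace_Euclidean_space)
        then show "b = (\<lambda>i. 0)"
          by (rule ext)
      qed
      \<comment> \<open>Multiplying zero coordinates by 0 changes nothing, so the chart sends them
        to a vector fixed by the scalar 0, that is, to the zero vector.\<close>
      then have "vscale E 0 s = s" "vscale E 0 u = u"
        using \<psi>scale[OF xW(1) a(1), of 0] \<xi>scale[OF xW(2) b(1), of 0] a(2) b(2) by simp_all
      then have "s = vzero E x" "u = vzero E x"
        using sE uE by simp_all
      moreover have "p (vzero E x) = 0"
        using norms by (auto simp: norm_on_def)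
      ultimately show ?thesis
        by (simp add: metric_norm_def inner_vzero_left)
    next
      case False
      then have r: "r > 0"
        using r0 unfolding r_def by linarith
      \<comment> \<open>Both sides of the claim are homogeneous of degree one in the pair
        \<open>(s, u)\<close>, so dividing by \<open>r\<close> reduces it to the sphere
        \<open>K\<close>.\<close>
      define y where "y = (\<lambda>i. inverse r * a i, \<lambda>j. inverse r * b j)"
      have "(\<Sum>i<k. \<bar>inverse r * a i\<bar>) + (\<Sum>j<l. \<bar>inverse r * b j\<bar>) = inverse r * r"
        using r by (simp add: r_def abs_mult distrib_left flip: sum_distrib_left)
      then have yK: "y \<in> K"
        using a b r by (auto simp: K_def y_def topspace_Euclidean_space)
      have t: "(x, y) \<in> topspace ?P"
        using yK topK xW xB by auto
      have \<alpha>: "\<alpha> (x, y) = vscale E (inverse r) s" and \<beta>: "\<beta> (x, y) = vscale E (inverse r) u"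
        using \<psi>scale[OF xW(1) a(1)] \<xi>scale[OF xW(2) b(1)] a(2) b(2)
        by (simp_all add: \<alpha>_def \<beta>_def y_def)
      have "p (\<alpha> (x, y)) \<le> M * h (x, y)"
        using M[rule_format, OF x, of y] yK hpos[OF t] unfolding topK by (simp add: field_simps)
      moreover have "p (\<alpha> (x, y)) = inverse r * p s"
        using norms sE r by (simp add: \<alpha> norm_on_def)
      moreover have "h (x, y) = inverse r * metric_norm g (vadd E s u)"
        using norm_on_metric_norm sE uE r
        by (simp add: h_eq[OF t] \<alpha> \<beta> norm_on_def flip: scl_add)
      ultimately show ?thesis
        using r by (simp add: field_simps)
    qed
  qed
qed

text \<open>Compactness of the base enters here: finitely many of the local neighbourhoods cover it,
  and their constants combine into one.\<close>

lemma splitting_dominated: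
  assumes B: "compact_space B" and E: "vector_bundle B E" and g: "riemannian_metric B E g"
    and FG: "continuous_splitting B E F G" and p: "continuous_norm B E p"
  obtains M where "0 < M"
    "\<And>x s u. x \<in> topspace B \<Longrightarrow> s \<in> F x \<Longrightarrow> u \<in> G x \<Longrightarrow>
      p s \<le> M * metric_norm g (vadd E s u)"
proof -
  let ?dom = "\<lambda>W M. \<forall>x\<in>W. \<forall>s\<in>F x. \<forall>u\<in>G x. p s \<le> M * metric_norm g (vadd E s u)"
  let ?U = "{W. openin B W \<and> (\<exists>M. ?dom W M)}"
  have "topspace B \<subseteq> \<Union>?U"
  proof
    fix x assume "x \<in> topspace B"
    then obtain W M where "openin B W" "x \<in> W"
      "\<And>y s u. y \<in> W \<Longrightarrow> s \<in> F y \<Longrightarrow> u \<in> G y \<Longrightarrow> p s \<le> M * metric_norm g (vadd E s u)"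
      using splitting_dominated_locally[OF E g FG p] by blast
    then show "x \<in> \<Union>?U"
      by blast
  qed
  then obtain \<F> where \<F>: "finite \<F>" "\<F> \<subseteq> ?U" "topspace B \<subseteq> \<Union>\<F>"
    using B unfolding compact_space_alt by (metis (no_types, lifting) mem_Collect_eq)
  then have "\<forall>W\<in>\<F>. \<exists>M. ?dom W M"
    by blast
  then obtain m where m: "\<And>W. W \<in> \<F> \<Longrightarrow> ?dom W (m W)"
    by metis
  \<comment> \<open>The sum of absolute values bounds every local constant, whatever its sign; the
    added 1 makes \<open>M\<close> positive even for an empty cover.\<close>
  define M where "M = 1 + (\<Sum>W\<in>\<F>. \<bar>m W\<bar>)"
  show thesis
  proof
    show "0 < M"
      unfolding M_def by (simp add: add_pos_nonneg sum_nonneg)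
    fix x s u assume x: "x \<in> topspace B" and s: "s \<in> F x" and u: "u \<in> G x"
    interpret inner_product_carrier "fiber E x" "vadd E" "vscale E" "vzero E x" g
      by (rule riemannian_metric_carrier[OF E g x])
    obtain W where W: "W \<in> \<F>" "x \<in> W"
      using \<F> x by blast
    have "\<bar>m W\<bar> \<le> (\<Sum>W\<in>\<F>. \<bar>m W\<bar>)"
      using \<F> W by (intro member_le_sum) auto
    then have mM: "m W \<le> M"
      by (simp add: M_def)
    have "0 \<le> metric_norm g (vadd E s u)"
      using subbundleD(1)[OF continuous_splittingD(1)[OF FG] x s]
        subbundleD(1)[OF continuous_splittingD(2)[OF FG] x u] inner_nonneg
      by (simp add: metric_norm_def)
    then have "m W * metric_norm g (vadd E s u) \<le> M * metric_norm g (vadd E s u)"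
      using mM by (rule mult_right_mono[rotated])
    then show "p s \<le> M * metric_norm g (vadd E s u)"
      using m[OF W(1)] W(2) s u by force
  qed
qed


subsection \<open>Components of a splitting\<close>

text \<open>The projection onto \<open>F\<close> along \<open>G\<close>. Exchanging the two families
  gives the complementary projection, so one definition serves both summands.\<close>

definition splitting_component ::
  "('x, 'e) bundle_data \<Rightarrow> ('x \<Rightarrow> 'e set) \<Rightarrow> ('x \<Rightarrow> 'e set) \<Rightarrow> 'e \<Rightarrow> 'e"
  where "splitting_component E F G v =
    (THE s. s \<in> F (proj E v) \<and> (\<exists>u\<in>G (proj E v). v = vadd E s u))"

lemma splitting_component_vadd:
  assumes E: "vector_bundle B E" and FG: "continuous_splitting B E F G" and x: "x \<in> topspace B"
    and s: "s \<in> F x" and u: "u \<in> G x"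
  shows "splitting_component E F G (vadd E s u) = s"
proof -
  interpret real_vector_carrier "fiber E x" "vadd E" "vscale E" "vzero E x"
    by (rule vector_bundle_carrier[OF E x])
  have "vadd E s u \<in> fiber E x"
    using subbundleD(1)[OF continuous_splittingD(1)[OF FG] x s]
      subbundleD(1)[OF continuous_splittingD(2)[OF FG] x u] by simp
  then have "proj E (vadd E s u) = x"
    by (rule fiberD)
  then show ?thesis
    unfolding splitting_component_def
  proof (intro the_equality)
    fix s' assume "s' \<in> F (proj E (vadd E s u)) \<and>
      (\<exists>u'\<in>G (proj E (vadd E s u)). vadd E s u = vadd E s' u')"
    then obtain u' where "s' \<in> F x" "u' \<in> G x" "vadd E s u = vadd E s' u'"
      using \<open>proj E (vadd E s u) = x\<close> by metis
    then show "s' = s"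
      using continuous_splitting_unique[OF E FG x s u] by blast
  qed (use s u in auto)
qed

lemma splitting_component_decomp:
  assumes E: "vector_bundle B E" and FG: "continuous_splitting B E F G" and x: "x \<in> topspace B"
    and v: "v \<in> fiber E x"
  shows "splitting_component E F G v \<in> F x" "splitting_component E G F v \<in> G x"
    "v = vadd E (splitting_component E F G v) (splitting_component E G F v)"
proof -
  interpret real_vector_carrier "fiber E x" "vadd E" "vscale E" "vzero E x"
    by (rule vector_bundle_carrier[OF E x])
  obtain s u where su: "s \<in> F x" "u \<in> G x" "v = vadd E s u"
    using continuous_splitting_ex[OF FG x v] by blast
  moreover have "v = vadd E u s"
    using su subbundleD(1)[OF continuous_splittingD(1)[OF FG] x]
      subbundleD(1)[OF continuous_splittingD(2)[OF FG] x] add_commute by metis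
  ultimately have "splitting_component E F G v = s" "splitting_component E G F v = u"
    using splitting_component_vadd[OF E FG x]
      splitting_component_vadd[OF E continuous_splitting_commute[OF E FG] x] by metis+
  then show "splitting_component E F G v \<in> F x" "splitting_component E G F v \<in> G x"
    "v = vadd E (splitting_component E F G v) (splitting_component E G F v)"
    using su by auto
qed

text \<open>Adding or scaling decompositions gives a decomposition again, since \<open>F\<close> and
  \<open>G\<close> are fiberwise subspaces, and decompositions are unique.\<close>

lemma splitting_component_linear:
  assumes E: "vector_bundle B E" and FG: "continuous_splitting B E F G" and x: "x \<in> topspace B"
    and v: "v \<in> fiber E x"
  shows "w \<in> fiber E x \<Longrightarrow> splitting_component E F G (vadd E v w) =
      vadd E (splitting_component E F G v) (splitting_component E F G w)"
    "splitting_component E F G (vscale E c v) = vscale E c (splitting_component E F G v)"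
proof -
  interpret real_vector_carrier "fiber E x" "vadd E" "vscale E" "vzero E x"
    by (rule vector_bundle_carrier[OF E x])
  note F = continuous_splittingD(1)[OF FG] and G = continuous_splittingD(2)[OF FG]
  note dec = splitting_component_decomp[OF E FG x]
  let ?P = "splitting_component E F G" and ?Q = "splitting_component E G F"
  have fib: "?P w \<in> fiber E x" "?Q w \<in> fiber E x" if "w \<in> fiber E x" for w
    using subbundleD(1)[OF F x dec(1)[OF that]] subbundleD(1)[OF G x dec(2)[OF that]] .
  show "?P (vadd E v w) = vadd E (?P v) (?P w)" if w: "w \<in> fiber E x"
  proof -
    have "vadd E v w = vadd E (vadd E (?P v) (?Q v)) (vadd E (?P w) (?Q w))"
      using dec(3)[OF v] dec(3)[OF w] by simp
    also have "\<dots> = vadd E (vadd E (?P v) (?P w)) (vadd E (?Q v) (?Q w))"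
      using fib[OF v] fib[OF w] by (intro add_add_swap)
    finally show ?thesis
      using splitting_component_vadd[OF E FG x subbundleD(3)[OF F x dec(1)[OF v] dec(1)[OF w]]
          subbundleD(3)[OF G x dec(2)[OF v] dec(2)[OF w]]] by simp
  qed
  have "vscale E c v = vscale E c (vadd E (?P v) (?Q v))"
    using dec(3)[OF v] by simp
  also have "\<dots> = vadd E (vscale E c (?P v)) (vscale E c (?Q v))"
    using fib[OF v] by (intro scl_add)
  finally show "?P (vscale E c v) = vscale E c (?P v)"
    using splitting_component_vadd[OF E FG x subbundleD(4)[OF F x dec(1)[OF v]]
        subbundleD(4)[OF G x dec(2)[OF v]]] by simp
qed

lemma splitting_component_subbundle:
  assumes E: "vector_bundle B E" and FG: "continuous_splitting B E F G" and x: "x \<in> topspace B"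
    and v: "v \<in> F x"
  shows "splitting_component E F G v = v" "splitting_component E G F v = vzero E x"
proof -
  interpret real_vector_carrier "fiber E x" "vadd E" "vscale E" "vzero E x"
    by (rule vector_bundle_carrier[OF E x])
  have vE: "v \<in> fiber E x"
    using subbundleD(1)[OF continuous_splittingD(1)[OF FG] x v] .
  have z: "vzero E x \<in> G x"
    using subbundleD(2)[OF continuous_splittingD(2)[OF FG] x] .
  show "splitting_component E F G v = v"
    using splitting_component_vadd[OF E FG x v z] vE by simp
  show "splitting_component E G F v = vzero E x"
    using splitting_component_vadd[OF E continuous_splitting_commute[OF E FG] x z v] vE by simp
qed

text \<open>The pointwise criterion is the usable one because the norm of a component is compared
  with a different continuous function near each point.\<close>

lemma continuous_map_euclideanreal_epsilon:
  assumes "\<And>x e. x \<in> topspace X \<Longrightarrow> 0 < e \<Longrightarrow>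
    \<exists>U. openin X U \<and> x \<in> U \<and> (\<forall>y\<in>U. \<bar>h y - h x\<bar> < e)"
  shows "continuous_map X euclideanreal h"
proof -
  have "continuous_map X Met_TC.mtopology h"
    unfolding Met_TC.continuous_map_to_metric
    using assms by (simp add: dist_real_def abs_minus_commute)
  then show ?thesis
    by simp
qed

text \<open>Near \<open>v\<^sub>0 = s\<^sub>0 + u\<^sub>0\<close>, extend \<open>s\<^sub>0\<close> and \<open>u\<^sub>0\<close> to local sections \<open>\<sigma>\<close> and \<open>\<rho>\<close> of the two
  subbundles. By domination the component of \<open>v\<close> in \<open>F\<close> differs from \<open>\<sigma>\<close> by at most a multiple
  of the norm of \<open>v - \<sigma> - \<rho>\<close>, which tends to \<open>0\<close>.\<close>

lemma continuous_map_norm_splitting_component: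
  assumes E: "vector_bundle B E" and g: "riemannian_metric B E g"
    and FG: "continuous_splitting B E F G" and p: "continuous_norm B E p" and M: "0 < M"
    and dom: "\<And>x s u. x \<in> topspace B \<Longrightarrow> s \<in> F x \<Longrightarrow> u \<in> G x \<Longrightarrow>
      p s \<le> M * metric_norm g (vadd E s u)"
  shows "continuous_map (total E) euclideanreal (\<lambda>v. p (splitting_component E F G v))"
proof (rule continuous_map_euclideanreal_epsilon)
  fix v0 and e :: real assume v0: "v0 \<in> topspace (total E)" and e: "0 < e"
  note F = continuous_splittingD(1)[OF FG] and G = continuous_splittingD(2)[OF FG]
  note dec = splitting_component_decomp[OF E FG]
  let ?P = "splitting_component E F G" and ?Q = "splitting_component E G F"
  define x0 where "x0 = proj E v0"
  have x0: "x0 \<in> topspace B" and v0x: "v0 \<in> fiber E x0"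
    using vector_bundle_proj[OF E v0] by (auto simp: x0_def)
  obtain U k \<psi> where \<psi>: "subbundle_chart B E F U k \<psi>" and xU: "x0 \<in> U"
    using subbundle_chart_exists[OF E F x0] .
  obtain V l \<xi> where \<xi>: "subbundle_chart B E G V l \<xi>" and xV: "x0 \<in> V"
    using subbundle_chart_exists[OF E G x0] .
  obtain a where a: "a \<in> topspace (Euclidean_space k)" "?P v0 = \<psi> (x0, a)"
    using subbundle_chartD(6)[OF \<psi> xU dec(1)[OF x0 v0x]] by blast
  obtain b where b: "b \<in> topspace (Euclidean_space l)" "?Q v0 = \<xi> (x0, b)"
    using subbundle_chartD(6)[OF \<xi> xV dec(2)[OF x0 v0x]] by blast
  \<comment> \<open>The local sections keep the chart coordinates of the components of
    \<open>v0\<close> fixed and move only the base point.\<close>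
  define \<sigma> where "\<sigma> = (\<lambda>v. \<psi> (proj E v, a))"
  define \<rho> where "\<rho> = (\<lambda>v. \<xi> (proj E v, b))"
  define Y where "Y = {v \<in> topspace (total E). proj E v \<in> U \<inter> V}"
  let ?T = "subtopology (total E) Y"
  have projc: "continuous_map (total E) B (proj E)"
    using E by (simp add: vector_bundle_def)
  have Y: "openin (total E) Y"
    unfolding Y_def using subbundle_chartD(1)[OF \<psi>] subbundle_chartD(1)[OF \<xi>]
    by (intro openin_continuous_map_preimage[OF projc]) auto
  have topT: "topspace ?T = Y"
    by (auto simp: Y_def)
  have YB: "proj E v \<in> topspace B" "v \<in> fiber E (proj E v)" if "v \<in> Y" for v
    using vector_bundle_proj[OF E] that by (auto simp: Y_def)
  have projT: "continuous_map ?T (subtopology B U) (proj E)" "continuous_map ?T (subtopology B V) (proj E)"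
    using continuous_map_from_subtopology[OF projc, of Y]
    by (auto simp: continuous_map_in_subtopology Y_def)
  have cont\<sigma>: "continuous_map ?T (total E) \<sigma>"
  proof -
    have "continuous_map ?T (prod_topology (subtopology B U) (Euclidean_space k)) (\<lambda>v. (proj E v, a))"
      using projT a(1) by (intro continuous_map_pairedI) auto
    from continuous_map_compose[OF this subbundle_chartD(2)[OF \<psi>]] show ?thesis
      by (simp add: \<sigma>_def o_def)
  qed
  have cont\<rho>: "continuous_map ?T (total E) \<rho>"
  proof -
    have "continuous_map ?T (prod_topology (subtopology B V) (Euclidean_space l)) (\<lambda>v. (proj E v, b))"
      using projT b(1) by (intro continuous_map_pairedI) auto
    from continuous_map_compose[OF this subbundle_chartD(2)[OF \<xi>]] show ?thesis
      by (simp add: \<rho>_def o_def)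
  qed
  have \<sigma>F: "\<sigma> v \<in> F (proj E v)" and \<rho>G: "\<rho> v \<in> G (proj E v)" if "v \<in> Y" for v
    using that subbundle_chartD(3)[OF \<psi> _ a(1)] subbundle_chartD(3)[OF \<xi> _ b(1)]
    by (auto simp: Y_def \<sigma>_def \<rho>_def)
  have \<sigma>E: "\<sigma> v \<in> fiber E (proj E v)" and \<rho>E: "\<rho> v \<in> fiber E (proj E v)" if "v \<in> Y" for v
    using subbundleD(1)[OF F YB(1)[OF that] \<sigma>F[OF that]]
      subbundleD(1)[OF G YB(1)[OF that] \<rho>G[OF that]] .
  have proj\<sigma>: "proj E (\<sigma> v) = proj E v" and proj\<rho>: "proj E (\<rho> v) = proj E v" if "v \<in> Y" for v
    using \<sigma>E[OF that] \<rho>E[OF that] by (auto dest: fiberD)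
  \<comment> \<open>This is the norm of \<open>v - \<sigma> v - \<rho> v\<close>, written so that
    only the metric is applied, and only to \<open>v\<close> and the two sections; its continuity is
    then immediate.\<close>
  define q where "q = (\<lambda>v. sqrt (g v v + (g (\<sigma> v) (\<sigma> v) + 2 * g (\<sigma> v) (\<rho> v) + g (\<rho> v) (\<rho> v))
      - 2 * (g v (\<sigma> v) + g v (\<rho> v))))"
  have q_eq: "q v = metric_norm g (vadd E (vadd E (?P v) (vscale E (-1) (\<sigma> v)))
      (vadd E (?Q v) (vscale E (-1) (\<rho> v))))" if v: "v \<in> Y" for v
  proof -
    let ?x = "proj E v"
    note x = YB(1)[OF v] and vx = YB(2)[OF v]
    interpret inner_product_carrier "fiber E ?x" "vadd E" "vscale E" "vzero E ?x" g
      by (rule riemannian_metric_carrier[OF E g x])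
    have "g (vadd E (\<sigma> v) (\<rho> v)) (vadd E (\<sigma> v) (\<rho> v)) =
        g (\<sigma> v) (\<sigma> v) + 2 * g (\<sigma> v) (\<rho> v) + g (\<rho> v) (\<rho> v)"
      using \<sigma>E[OF v] \<rho>E[OF v] by (simp add: inner_expand inner_commute[of "\<rho> v" "\<sigma> v"])
    then show ?thesis
      using inner_diff_diff[OF \<sigma>E[OF v] \<rho>E[OF v] subbundleD(1)[OF F x dec(1)[OF x vx]]
          subbundleD(1)[OF G x dec(2)[OF x vx]]]
      by (simp add: q_def metric_norm_def flip: dec(3)[OF x vx])
  qed
  have contq: "continuous_map ?T euclideanreal q"
    unfolding q_def using cont\<sigma> cont\<rho> proj\<sigma> proj\<rho> topT
    by (intro continuous_map_sqrt continuous_map_add continuous_map_diff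
        continuous_map_real_mult_left continuous_map_riemannian_metric[OF g])
      (auto intro: continuous_map_from_subtopology continuous_map_id[unfolded id_def])
  have "continuous_map (total E) euclideanreal p"
    using p by (simp add: continuous_norm_def)
  then have "continuous_map ?T euclideanreal (\<lambda>v. p (\<sigma> v))"
    using continuous_map_compose[OF cont\<sigma>] by (fastforce simp: o_def)
  \<comment> \<open>A continuous majorant of the variation to be estimated; it vanishes at
    \<open>v0\<close>, so its sublevel set below \<open>e\<close> is the required
    neighbourhood.\<close>
  then have "continuous_map ?T euclideanreal (\<lambda>v. \<bar>p (\<sigma> v) - p (?P v0)\<bar> + M * q v)"
    using contq by (intro continuous_map_add continuous_map_real_abs continuous_map_diff
        continuous_map_real_mult_left) auto
  from openin_continuous_map_preimage[OF this, of "{..<e}"]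
  have O': "openin ?T {v \<in> Y. \<bar>p (\<sigma> v) - p (?P v0)\<bar> + M * q v < e}" (is "openin ?T ?O")
    unfolding topT by simp
  show "\<exists>U. openin (total E) U \<and> v0 \<in> U \<and> (\<forall>v\<in>U. \<bar>p (?P v) - p (?P v0)\<bar> < e)"
  proof (intro exI conjI ballI)
    show "openin (total E) ?O"
      using O' Y by (rule openin_trans_full)
    have v0Y: "v0 \<in> Y"
      using v0 xU xV by (simp add: Y_def x0_def)
    have "q v0 = 0"
    proof -
      interpret inner_product_carrier "fiber E x0" "vadd E" "vscale E" "vzero E x0" g
        by (rule riemannian_metric_carrier[OF E g x0])
      have "\<sigma> v0 = ?P v0" "\<rho> v0 = ?Q v0"
        using a b by (simp_all add: \<sigma>_def \<rho>_def x0_def)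
      then show ?thesis
        using q_eq[OF v0Y] vdiff_self[OF \<sigma>E[OF v0Y, folded x0_def]]
          vdiff_self[OF \<rho>E[OF v0Y, folded x0_def]]
        by (simp add: metric_norm_def inner_vzero_left)
    qed
    then show "v0 \<in> ?O"
      using v0Y e a by (simp add: \<sigma>_def x0_def)
    fix v assume "v \<in> ?O"
    then have v: "v \<in> Y" and small: "\<bar>p (\<sigma> v) - p (?P v0)\<bar> + M * q v < e"
      by auto
    let ?x = "proj E v"
    note x = YB(1)[OF v] and vx = YB(2)[OF v]
    interpret inner_product_carrier "fiber E ?x" "vadd E" "vscale E" "vzero E ?x" g
      by (rule riemannian_metric_carrier[OF E g x])
    have "\<bar>p (?P v) - p (\<sigma> v)\<bar> \<le> p (diff (?P v) (\<sigma> v))"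
      using p x subbundleD(1)[OF F x dec(1)[OF x vx]] \<sigma>E[OF v]
      by (intro norm_on_diff) (auto simp: continuous_norm_def)
    \<comment> \<open>Domination is applied to the decomposition of
      \<open>v - \<sigma> v - \<rho> v\<close> into a difference in \<open>F\<close> and a
      difference in \<open>G\<close>.\<close>
    also have "\<dots> \<le> M * q v"
      unfolding q_eq[OF v]
      by (intro dom[OF x] subbundleD(3,4)[OF F x] subbundleD(3,4)[OF G x] dec(1,2)[OF x vx]
          \<sigma>F[OF v] \<rho>G[OF v])
    finally show "\<bar>p (?P v) - p (?P v0)\<bar> < e"
      using small by linarith
  qed
qed

text \<open>Domination is used once for each summand: the two constants add up to the upper bound,
  and each also yields continuity of its own term. The norm axioms pass to the sum because both
  projections are linear and jointly injective.\<close>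

lemma splitting_sum_norm:
  assumes B: "compact_space B" and E: "vector_bundle B E" and g: "riemannian_metric B E g"
    and FG: "continuous_splitting B E F G"
    and p: "continuous_norm B E p" and q: "continuous_norm B E q"
  obtains M where "0 < M"
    "continuous_norm B E
      (\<lambda>v. p (splitting_component E F G v) + q (splitting_component E G F v))"
    "\<And>x v. x \<in> topspace B \<Longrightarrow> v \<in> fiber E x \<Longrightarrow>
      p (splitting_component E F G v) + q (splitting_component E G F v) \<le> M * metric_norm g v"
proof -
  let ?P = "splitting_component E F G" and ?Q = "splitting_component E G F"
  let ?N = "\<lambda>v. p (?P v) + q (?Q v)"
  note F = continuous_splittingD(1)[OF FG] and G = continuous_splittingD(2)[OF FG]
  note GF = continuous_splitting_commute[OF E FG]
  note dec = splitting_component_decomp[OF E FG]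
  obtain M1 where M1: "0 < M1" "\<And>x s u. x \<in> topspace B \<Longrightarrow> s \<in> F x \<Longrightarrow> u \<in> G x \<Longrightarrow>
      p s \<le> M1 * metric_norm g (vadd E s u)"
    using splitting_dominated[OF B E g FG p] by blast
  obtain M2 where M2: "0 < M2" "\<And>x s u. x \<in> topspace B \<Longrightarrow> s \<in> G x \<Longrightarrow> u \<in> F x \<Longrightarrow>
      q s \<le> M2 * metric_norm g (vadd E s u)"
    using splitting_dominated[OF B E g GF q] by blast
  show thesis
  proof
    show "0 < M1 + M2"
      using M1 M2 by simp
    show "?N v \<le> (M1 + M2) * metric_norm g v" if x: "x \<in> topspace B" and v: "v \<in> fiber E x" for x v
      using M1(2)[OF x dec(1,2)[OF x v]] M2(2)[OF x dec(2,1)[OF x v]] dec(3)[OF x v]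
        splitting_component_decomp(3)[OF E GF x v]
      by (simp add: distrib_right)
    have "continuous_map (total E) euclideanreal ?N"
      using continuous_map_norm_splitting_component[OF E g FG p M1]
        continuous_map_norm_splitting_component[OF E g GF q M2] by (intro continuous_map_add)
    moreover have "norm_on (fiber E x) (vadd E) (vscale E) (vzero E x) ?N"
      if x: "x \<in> topspace B" for x
    proof -
      interpret real_vector_carrier "fiber E x" "vadd E" "vscale E" "vzero E x"
        by (rule vector_bundle_carrier[OF E x])
      have np: "norm_on (fiber E x) (vadd E) (vscale E) (vzero E x) p"
        and nq: "norm_on (fiber E x) (vadd E) (vscale E) (vzero E x) q"
        using p q x by (auto simp: continuous_norm_def)
      have fib: "?P v \<in> fiber E x" "?Q v \<in> fiber E x" if "v \<in> fiber E x" for v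
        using subbundleD(1)[OF F x dec(1)[OF x that]] subbundleD(1)[OF G x dec(2)[OF x that]] .
      show ?thesis
        unfolding norm_on_def
      proof (intro conjI ballI allI)
        fix v w assume v: "v \<in> fiber E x" and w: "w \<in> fiber E x"
        have "p (?P (vadd E v w)) \<le> p (?P v) + p (?P w)"
          using splitting_component_linear(1)[OF E FG x v w] np fib[OF v] fib[OF w]
          by (simp add: norm_on_def)
        moreover have "q (?Q (vadd E v w)) \<le> q (?Q v) + q (?Q w)"
          using splitting_component_linear(1)[OF E GF x v w] nq fib[OF v] fib[OF w]
          by (simp add: norm_on_def)
        ultimately show "?N (vadd E v w) \<le> ?N v + ?N w"
          by simp
      next
        fix c v assume v: "v \<in> fiber E x"
        show "?N (vscale E c v) = \<bar>c\<bar> * ?N v"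
          using splitting_component_linear(2)[OF E FG x v, of c]
            splitting_component_linear(2)[OF E GF x v, of c] np nq fib[OF v]
          by (simp add: norm_on_def distrib_left)
      next
        fix v assume v: "v \<in> fiber E x"
        have nonneg: "0 \<le> p (?P v)" "0 \<le> q (?Q v)"
          using np nq fib[OF v] by (auto simp: norm_on_def)
        then show "0 \<le> ?N v"
          by simp
        show "?N v = 0 \<longleftrightarrow> v = vzero E x"
        proof
          assume "?N v = 0"
          then have "p (?P v) = 0" "q (?Q v) = 0"
            using nonneg by simp_all
          then have "?P v = vzero E x" "?Q v = vzero E x"
            using np nq fib[OF v] by (auto simp: norm_on_def)
          then show "v = vzero E x"
            using dec(3)[OF x v] by simp
        next
          have "p (vzero E x) = 0" "q (vzero E x) = 0"
            using np nq by (auto simp: norm_on_def)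
          moreover assume "v = vzero E x"
          ultimately show "?N v = 0"
            using splitting_component_subbundle[OF E FG x subbundleD(2)[OF F x]] by simp
        qed
      qed
    qed
    ultimately show "continuous_norm B E ?N"
      by (simp add: continuous_norm_def)
  qed
qed

subsection \<open>Hyperbolic automorphisms\<close>

theorem proposition2p1:
  fixes X :: "'x set" and d :: "'x \<Rightarrow> 'x \<Rightarrow> real"
    and E :: "('x, 'e) bundle_data" and g :: "'e \<Rightarrow> 'e \<Rightarrow> real"
    and f :: "'x \<Rightarrow> 'x" and A :: "'e \<Rightarrow> 'e" and Es Eu :: "'x \<Rightarrow> 'e set"
  assumes "Metric_space X d"
    and "compact_space (Metric_space.mtopology X d)"
    and "vector_bundle (Metric_space.mtopology X d) E"
    and "riemannian_metric (Metric_space.mtopology X d) E g"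
    and "hyperbolic_automorphism (Metric_space.mtopology X d) E (metric_norm g) f A Es Eu"
  shows "\<exists>N \<tau>. continuous_norm (Metric_space.mtopology X d) E N \<and> 0 < \<tau> \<and> \<tau> < 1 \<and>
    (\<forall>x\<in>X. (\<forall>v\<in>Es x. N (A v) \<le> \<tau> * N v) \<and>
           (\<forall>v\<in>Eu x. N (bundle_inv E A v) \<le> \<tau> * N v)) \<and>
    (\<exists>r1>0. \<exists>r2>0. \<forall>x\<in>X. \<forall>v\<in>fiber E x.
       r1 * metric_norm g v \<le> N v \<and> N v \<le> r2 * metric_norm g v)"
proof -
  let ?B = "Metric_space.mtopology X d"
  have X: "topspace ?B = X"
    using assms(1) by (rule Metric_space.topspace_mtopology)
  note E = assms(3) and g = assms(4)
  let ?I = "bundle_inv E A"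
  have A: "bundle_automorphism ?B E f A" and split: "continuous_splitting ?B E Es Eu"
    and inv: "\<And>x. x \<in> X \<Longrightarrow> A ` Es x = Es (f x)" "\<And>x. x \<in> X \<Longrightarrow> A ` Eu x = Eu (f x)"
    using assms(5) by (auto simp: hyperbolic_automorphism_def X)
  obtain C l where l: "0 < l" "l < 1"
    and contr_s: "\<forall>n. \<forall>x\<in>topspace ?B. \<forall>v\<in>Es x.
      metric_norm g ((A ^^ n) v) \<le> C * l ^ n * metric_norm g v"
    and contr_u: "\<forall>n. \<forall>x\<in>topspace ?B. \<forall>v\<in>Eu x.
      metric_norm g ((?I ^^ n) v) \<le> C * l ^ n * metric_norm g v"
    using assms(5) unfolding hyperbolic_automorphism_def by metis
  note Es = continuous_splittingD(1)[OF split] and Eu = continuous_splittingD(2)[OF split]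
  note split' = continuous_splitting_commute[OF E split]
  note ng = continuous_norm_metric_norm[OF E g]
  have EsE: "Es x \<subseteq> fiber E x" and EuE: "Eu x \<subseteq> fiber E x" if "x \<in> topspace ?B" for x
    using subbundleD(1)[OF Es that] subbundleD(1)[OF Eu that] by auto
  obtain p \<mu> where p: "continuous_norm ?B E p" and \<mu>: "0 < \<mu>" "\<mu> < 1"
    and p_contr: "\<And>x v. x \<in> topspace ?B \<Longrightarrow> v \<in> Es x \<Longrightarrow> p (A v) \<le> \<mu> * p v"
    and p_ge: "\<And>v. v \<in> topspace (total E) \<Longrightarrow> metric_norm g v \<le> p v"
    using adapted_norm[OF E ng A EsE l contr_s] by blast
  obtain q \<nu> where q: "continuous_norm ?B E q" and \<nu>: "0 < \<nu>" "\<nu> < 1"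
    and q_contr: "\<And>x v. x \<in> topspace ?B \<Longrightarrow> v \<in> Eu x \<Longrightarrow> q (?I v) \<le> \<nu> * q v"
    and q_ge: "\<And>v. v \<in> topspace (total E) \<Longrightarrow> metric_norm g v \<le> q v"
    using adapted_norm[OF E ng bundle_automorphism_bundle_inv[OF E A] EuE l contr_u] by blast
  let ?P = "splitting_component E Es Eu" and ?Q = "splitting_component E Eu Es"
  define N where "N = (\<lambda>v. p (?P v) + q (?Q v))"
  obtain M where M: "0 < M" and contN: "continuous_norm ?B E N"
    and N_le: "\<And>x v. x \<in> topspace ?B \<Longrightarrow> v \<in> fiber E x \<Longrightarrow> N v \<le> M * metric_norm g v"
    using splitting_sum_norm[OF assms(2) E g split p q] unfolding N_def by blast
  have zero: "p (vzero E x) = 0" "q (vzero E x) = 0" if "x \<in> topspace ?B" for x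
    using p q that subbundleD(1)[OF Es that subbundleD(2)[OF Es that]]
    by (auto simp: continuous_norm_def norm_on_def)
  \<comment> \<open>A stable vector has zero unstable component, so \<open>N\<close> restricts to
    \<open>p\<close> there, and likewise to \<open>q\<close> on \<open>Eu\<close>; the contraction
    estimates carry over unchanged.\<close>
  have N_s: "N v = p v" if "x \<in> topspace ?B" "v \<in> Es x" for x v
    using splitting_component_subbundle[OF E split that] zero[OF that(1)] by (simp add: N_def)
  have N_u: "N v = q v" if "x \<in> topspace ?B" "v \<in> Eu x" for x v
    using splitting_component_subbundle[OF E split' that] zero[OF that(1)] by (simp add: N_def)
  have N_nonneg: "0 \<le> N v" if "x \<in> topspace ?B" "v \<in> fiber E x" for x v
    using contN that by (auto simp: continuous_norm_def norm_on_def)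
  have f: "homeomorphic_map ?B ?B f" and AT: "homeomorphic_map (total E) (total E) A"
    using A by (auto simp: bundle_automorphism_def)
  have "N (A v) \<le> max \<mu> \<nu> * N v" if x: "x \<in> X" and v: "v \<in> Es x" for x v
  proof -
    have x': "x \<in> topspace ?B" "f x \<in> topspace ?B"
      using x X homeomorphic_imp_surjective_map[OF f] by auto
    have "A v \<in> Es (f x)"
      using inv(1)[OF x] v by blast
    then have "N (A v) \<le> \<mu> * N v"
      using p_contr[OF x'(1) v] N_s[OF x'(1) v] N_s[OF x'(2)] by simp
    also have "\<dots> \<le> max \<mu> \<nu> * N v"
      using N_nonneg[OF x'(1)] EsE[OF x'(1)] v by (intro mult_right_mono) auto
    finally show ?thesis .
  qed
  moreover have "N (?I v) \<le> max \<mu> \<nu> * N v" if x: "x \<in> X" and v: "v \<in> Eu x" for x v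
  proof -
    have xB: "x \<in> topspace ?B"
      using x X by simp
    \<comment> \<open>Invariance of \<open>Eu\<close> under \<open>A\<close> is read backwards:
      \<open>v\<close> is the image of some \<open>w\<close> in \<open>Eu y\<close>, hence the
      inverse image of \<open>v\<close> is again unstable and \<open>N\<close> equals
      \<open>q\<close> at it.\<close>
    then obtain y where y: "y \<in> topspace ?B" "x = f y"
      using homeomorphic_imp_surjective_map[OF f] by blast
    then obtain w where w: "w \<in> Eu y" "v = A w"
      using inv(2)[of y] v X by auto
    have "w \<in> topspace (total E)"
      using EuE[OF y(1)] w(1) by (auto dest: fiberD)
    then have "?I v = w"
      using w(2) homeomorphic_imp_injective_map[OF AT] by (simp add: bundle_inv_def)
    then have "N (?I v) \<le> \<nu> * N v"
      using q_contr[OF xB v] N_u[OF xB v] N_u[OF y(1) w(1)] by simp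
    also have "\<dots> \<le> max \<mu> \<nu> * N v"
      using N_nonneg[OF xB] EuE[OF xB] v by (intro mult_right_mono) auto
    finally show ?thesis .
  qed
  \<comment> \<open>The lower constant is 1: \<open>p\<close> and \<open>q\<close> each dominate the
    metric norm, and the triangle inequality adds the two components.\<close>
  moreover have bounds: "1 * metric_norm g v \<le> N v \<and> N v \<le> M * metric_norm g v"
    if x: "x \<in> X" and v: "v \<in> fiber E x" for x v
  proof -
    have xB: "x \<in> topspace ?B"
      using x X by simp
    note dec = splitting_component_decomp[OF E split xB v]
    have fib: "?P v \<in> fiber E x" "?Q v \<in> fiber E x"
      using EsE[OF xB] EuE[OF xB] dec by auto
    have "metric_norm g (vadd E (?P v) (?Q v)) \<le> metric_norm g (?P v) + metric_norm g (?Q v)"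
      using ng xB fib unfolding continuous_norm_def norm_on_def by blast
    also have "\<dots> \<le> N v"
      unfolding N_def using fib by (intro add_mono p_ge q_ge) (auto dest: fiberD)
    finally show ?thesis
      using N_le[OF xB v] dec(3) by simp
  qed
  moreover have "0 < max \<mu> \<nu>" "max \<mu> \<nu> < 1"
    using \<mu> \<nu> by auto
  moreover have "\<exists>r1>0. \<exists>r2>0. \<forall>x\<in>X. \<forall>v\<in>fiber E x.
      r1 * metric_norm g v \<le> N v \<and> N v \<le> r2 * metric_norm g v"
    using bounds M zero_less_one by blast
  ultimately show ?thesis
    using contN by (intro exI[of _ N] exI[of _ "max \<mu> \<nu>"]) blast
qed

end
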